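(* Let $\mu_1$ and $\mu_3$ be probability measures on $\mathbb{R}$ with finite variances $\sigma_1^2$ and $\sigma_3^2$, and let $w_3:\mathbb{C}_{2\sqrt2\sigma_1}\to\mathbb{C}^+$ be the associated subordination function (defined in the context). The function $\tilde F_2(z)=F_{\mu_3}\big(w_3(z+2\sqrt2\sigma_1 i)\big)$ is analytic on $\mathbb{C}^+$ and there exists a probability measure $\tilde\mu$ on $\mathbb{R}$ such that $\tilde F_2=F_{\tilde\mu}$. Moreover $\tilde\mu$ satisfies $$\mu_1\boxplus\tilde\mu=\mu_3\boxplus\mathcal{C}_{2\sqrt2\sigma_1},$$ where $\mathcal{C}_{2\sqrt2\sigma_1}$ denotes the (centered) Cauchy distribution with parameter $2\sqrt2\sigma_1$.
   Context: $\mathbb{C}^+$ is the open upper half-plane; for real $\sigma$, $\mathbb{C}_\sigma=\{z\in\mathbb{C}:\Im z>\sigma\}$. For a probability measure $\mu$ on $\mathbb{R}$, $G_\mu(z)=\int_{\mathbb{R}}\frac{1}{z-t}\,d\mu(t)$ for $z\in\mathbb{C}^+$ and $F_\mu=1/G_\mu:\mathbb{C}^+\to\mathbb{C}^+$. $\boxplus$ is the free additive convolution of probability measures on $\mathbb{R}$ (for arbitrary probability measures, not necessarily with finite variance), characterized by $\phi_{\mu\boxplus\nu}=\phi_\mu+\phi_\nu$ on a common domain, where $\phi_\mu(z)=F_\mu^{\langle-1\rangle}(z)-z$ ($F_\mu^{\langle -1\rangle}$ is the compositional inverse of $F_\mu$ near infinity). The Cauchy distribution $\mathcal{C}_\lambda$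 has density $\frac1\pi\frac{\lambda}{x^2+\lambda^2}$, so $F_{\mathcal{C}_\lambda}(z)=z+i\lambda$. Definition of $w_3$: put $h_1(w)=w-F_{\mu_1}(w)$, $\tilde h_3(w)=F_{\mu_3}(w)+w$ and, for $z\in\mathbb{C}_{2\sqrt2\sigma_1}$, $T_z(w)=h_1(\tilde h_3(w)-z)+z$. For any $w$ with $\Im w>\frac34\Im z$, the iterates $T_z^{\circ n}(w)$ converge to a point of $\mathbb{C}^+$ independent of $w$; this limit is $w_3(z)$, and it is the unique fixed point of $T_z$ in $\{w:\Im w>\frac34\Im z\}$. *)

theory Defs
  imports "HOL-Probability.Probability"
begin

definition half_plane :: "real \<Rightarrow> complex set" where
  "half_plane s = {z. Im z > s}"

text \<open>
  Probability measures on the line are rendered by the library locale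
  \<^locale>\<open>real_distribution\<close>. The two transforms below are only used on
  \<open>half_plane 0\<close>; their values elsewhere carry no meaning.
\<close>

definition cauchy_transform :: "real measure \<Rightarrow> complex \<Rightarrow> complex" where
  "cauchy_transform \<mu> z = (LINT t|\<mu>. 1 / (z - complex_of_real t))"

definition F_transform :: "real measure \<Rightarrow> complex \<Rightarrow> complex" where
  "F_transform \<mu> z = 1 / cauchy_transform \<mu> z"


text \<open>
  The parameter \<open>0\<close> gives the point mass at the origin, so that the \<open>F\<close>-transform is
  \<open>z + \<i>c\<close> for every \<open>c \<ge> 0\<close>; the density formula alone would give the null measure there.
\<close>

definition cauchy_distribution :: "real \<Rightarrow> real measure" where
  "cauchy_distribution c =
     (if c = 0 then return borel 0
      else density lborel (\<lambda>x. ennreal (1 / pi * (c / (x\<^sup>2 + c\<^sup>2)))))"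


text \<open>
  Following Bercovici and Voiculescu, the compositional inverse near infinity of the
  \<open>F\<close>-transform of an arbitrary probability measure lives on truncated cones: it inverts the
  restriction of the \<open>F\<close>-transform to a truncated cone on which that transform is injective.
  Being a right inverse with values in the upper half-plane would not determine it: for
  \<open>F(w) = w - 1/w\<close> (the symmetric Bernoulli law) the equation \<open>F(w) = z\<close> has, for large \<open>z\<close>,
  two solutions in the upper half-plane, one close to \<open>z\<close> and one close to \<open>-1/z\<close>.
\<close>

definition truncated_cone :: "real \<Rightarrow> real \<Rightarrow> complex set" where
  "truncated_cone \<alpha> \<beta> = {z. Im z > \<beta> \<and> \<bar>Re z\<bar> < \<alpha> * Im z}"

definition is_F_inverse_on :: "real measure \<Rightarrow> complex set \<Rightarrow> (complex \<Rightarrow> complex) \<Rightarrow> bool" where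
  "is_F_inverse_on \<mu> D g \<longleftrightarrow>
     (\<exists>\<alpha>>0. \<exists>\<beta>>0. inj_on (F_transform \<mu>) (truncated_cone \<alpha> \<beta>) \<and>
        (\<forall>z\<in>D. g z \<in> truncated_cone \<alpha> \<beta> \<and> F_transform \<mu> (g z) = z))"

definition is_voiculescu_transform_on ::
    "real measure \<Rightarrow> complex set \<Rightarrow> (complex \<Rightarrow> complex) \<Rightarrow> bool" where
  "is_voiculescu_transform_on \<mu> D \<phi> \<longleftrightarrow>
     (\<exists>g. is_F_inverse_on \<mu> D g \<and> (\<forall>z\<in>D. \<phi> z = g z - z))"

definition is_free_conv :: "real measure \<Rightarrow> real measure \<Rightarrow> real measure \<Rightarrow> bool" where
  "is_free_conv \<mu> \<nu> \<rho> \<longleftrightarrow> real_distribution \<rho> \<and>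
     (\<exists>\<alpha>>0. \<exists>\<beta>>0. \<exists>\<phi>\<^sub>\<mu> \<phi>\<^sub>\<nu> \<phi>\<^sub>\<rho>.
        is_voiculescu_transform_on \<mu> (truncated_cone \<alpha> \<beta>) \<phi>\<^sub>\<mu> \<and>
        is_voiculescu_transform_on \<nu> (truncated_cone \<alpha> \<beta>) \<phi>\<^sub>\<nu> \<and>
        is_voiculescu_transform_on \<rho> (truncated_cone \<alpha> \<beta>) \<phi>\<^sub>\<rho> \<and>
        (\<forall>z\<in>truncated_cone \<alpha> \<beta>. \<phi>\<^sub>\<rho> z = \<phi>\<^sub>\<mu> z + \<phi>\<^sub>\<nu> z))"

definition free_conv :: "real measure \<Rightarrow> real measure \<Rightarrow> real measure" (infixl \<open>\<boxplus>\<close> 65) where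
  "\<mu> \<boxplus> \<nu> = (THE \<rho>. is_free_conv \<mu> \<nu> \<rho>)"


definition h_fun :: "real measure \<Rightarrow> complex \<Rightarrow> complex" where
  "h_fun \<mu> w = w - F_transform \<mu> w"

definition h_tilde :: "real measure \<Rightarrow> complex \<Rightarrow> complex" where
  "h_tilde \<mu> w = F_transform \<mu> w + w"

definition T_map :: "real measure \<Rightarrow> real measure \<Rightarrow> complex \<Rightarrow> complex \<Rightarrow> complex" where
  "T_map \<mu>\<^sub>1 \<mu>\<^sub>3 z w = h_fun \<mu>\<^sub>1 (h_tilde \<mu>\<^sub>3 w - z) + z"

text \<open>Only meaningful for \<open>z \<in> half_plane (2 * sqrt 2 * \<sigma>\<^sub>1)\<close>, \<open>\<sigma>\<^sub>1\<^sup>2\<close> the variance of \<open>\<mu>\<^sub>1\<close>.\<close>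

definition w3 :: "real measure \<Rightarrow> real measure \<Rightarrow> complex \<Rightarrow> complex" where
  "w3 \<mu>\<^sub>1 \<mu>\<^sub>3 z = (THE l. Im l > 0 \<and>
     (\<forall>w. Im w > 3/4 * Im z \<longrightarrow> (\<lambda>n. (T_map \<mu>\<^sub>1 \<mu>\<^sub>3 z ^^ n) w) \<longlonglongrightarrow> l))"

definition F2_tilde :: "real measure \<Rightarrow> real measure \<Rightarrow> real \<Rightarrow> complex \<Rightarrow> complex" where
  "F2_tilde \<mu>\<^sub>1 \<mu>\<^sub>3 \<sigma>\<^sub>1 z =
     F_transform \<mu>\<^sub>3 (w3 \<mu>\<^sub>1 \<mu>\<^sub>3 (z + complex_of_real (2 * sqrt 2 * \<sigma>\<^sub>1) * \<i>))"

end

theory Submission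
  imports Defs "HOL-Complex_Analysis.Complex_Analysis"
begin

text \<open>
  Write \<open>F\<^sub>1\<close>, \<open>F\<^sub>3\<close> for the \<open>F\<close>-transforms of \<open>\<mu>\<^sub>1\<close>, \<open>\<mu>\<^sub>3\<close> and \<open>c = 2 sqrt 2 \<sigma>\<^sub>1\<close>.  With \<open>w = w\<^sub>3 z\<close> and
  \<open>a = F\<^sub>3 w + w - z\<close>, the fixed point equation \<open>w = T\<^sub>z w\<close> is equivalent to
  \<open>F\<^sub>1 a = F\<^sub>3 w\<close>.  Call the common value \<open>x\<close>; it is also the value of the function under study at \<open>z - i c\<close>.
  If this function is the \<open>F\<close>-transform of a measure \<open>\<mu>\<^sub>t\<close>, then \<open>a\<close>, \<open>z - i c\<close> and \<open>w\<close> are the preimages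
  of \<open>x\<close> under the \<open>F\<close>-transforms of \<open>\<mu>\<^sub>1\<close>, \<open>\<mu>\<^sub>t\<close> and \<open>\<mu>\<^sub>3\<close>, and the definition of \<open>a\<close> becomes
  \<open>(a - x) + (z - i c - x) = (w - x) - i c\<close>.  In terms of Voiculescu transforms this is
  \<open>\<phi>\<^sub>1 + \<phi>\<^sub>t = \<phi>\<^sub>3 - i c\<close>, and \<open>- i c\<close> is the Voiculescu transform of the Cauchy distribution.  Both free
  convolutions are thus the measure \<open>\<rho>\<close> with \<open>F\<close>-transform \<open>F\<^sub>3 (z + i c)\<close>.

  Four analytic facts turn this computation into a proof.
  (i) For finite variance \<open>\<sigma>\<^sup>2\<close> and mean \<open>m\<close>, \<open>\<bar>w - m - F w\<bar> \<le> \<sigma>\<^sup>2 / Im w\<close> (\<open>F_transform_near_shift\<close>).  Hence \<open>T\<^sub>z\<close> maps the half-plane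
  \<open>Im w > 3/4 Im z\<close> into a disc compactly contained in it, and such a map has
  a fixed point that attracts every orbit (\<open>half_plane_self_map_iterates_converge\<close>).  The limit \<open>w\<^sub>3\<close> is
  holomorphic by Montel's theorem, and \<open>w\<^sub>3 z - z\<close> is bounded.
  (ii) A holomorphic \<open>F\<close> with \<open>Im F z \<ge> Im z\<close>, for which \<open>F z - z\<close> is bounded on every
  half-plane \<open>Im z \<ge> e > 0\<close>, is the \<open>F\<close>-transform of a probability measure (\<open>F_transform_exists\<close>).  This
  yields both \<open>\<mu>\<^sub>t\<close> and \<open>\<rho>\<close>.
  (iii) For an arbitrary probability measure \<open>F z / z \<rightarrow> 1\<close> in cones; therefore \<open>F\<close> is injective
  and has a right inverse on truncated cones (\<open>F_transform_inj_on_cone\<close>, \<open>F_transform_right_inverse\<close>).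
  (iv) Inverses on different cones agree high up on the imaginary axis, and the \<open>F\<close>-transform determines the
  measure (\<open>F_transform_unique\<close>).  So a free convolution, when it exists, is unique (\<open>is_free_conv_unique\<close>), and
  exhibiting \<open>\<rho>\<close> identifies both sides.
\<close>

section \<open>Cauchy transforms and F-transforms\<close>

lemma half_plane_iff [simp]: "z \<in> half_plane s \<longleftrightarrow> Im z > s"
  by (simp add: half_plane_def)

lemma open_half_plane: "open (half_plane s)"
  unfolding half_plane_def by (simp add: open_halfspace_Im_gt)

lemma convex_half_plane: "convex (half_plane s)"
  unfolding half_plane_def by (simp add: convex_halfspace_Im_gt)

lemma norm_resolvent_le:
  assumes "Im z > 0"
  shows "norm (1 / (z - complex_of_real t)) \<le> 1 / Im z"
proof -
  have "Im z \<le> norm (z - complex_of_real t)"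
    using abs_Im_le_cmod[of "z - complex_of_real t"] by simp
  then show ?thesis
    using assms by (simp add: norm_divide frac_le)
qed

lemma resolvent_nonzero:
  assumes "Im z > 0"
  shows "z - complex_of_real t \<noteq> 0"
  using assms by (auto simp: complex_eq_iff)

lemma Im_inverse_complex: "Im (1 / w) = - Im w * (cmod (1 / w))\<^sup>2"
  by (cases "w = 0") (simp_all add: Im_divide norm_divide power_divide cmod_power2)

text \<open>
  The resolvent identity, in the shape that turns a difference quotient of \<open>z \<mapsto> 1 / (z - t)\<close> into a product.
\<close>

lemma inverse_diff_inverse_complex:
  fixes a b :: complex
  assumes "a \<noteq> 0" "b \<noteq> 0"
  shows "1 / a - 1 / b = (a - b) * (- (1 / a) * (1 / b))"
  using assms by (simp add: field_simps)

lemma cmod_diff_power2: "(cmod (a - b))\<^sup>2 = (cmod a)\<^sup>2 - 2 * Re (a * cnj b) + (cmod b)\<^sup>2"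
  unfolding cmod_power2 by (simp add: power2_eq_square algebra_simps)

context real_distribution
begin

lemma integrable_resolvent:
  assumes "Im z > 0"
  shows "integrable M (\<lambda>t. 1 / (z - complex_of_real t))"
  by (rule integrable_const_bound[of _ "1 / Im z"]) (use norm_resolvent_le[OF assms] in auto)

lemma integrable_resolvent_power2:
  assumes "Im z > 0"
  shows "integrable M (\<lambda>t. (cmod (1 / (z - complex_of_real t)))\<^sup>2)"
proof (rule integrable_const_bound[of _ "(1 / Im z)\<^sup>2"])
  show "AE t in M. norm ((cmod (1 / (z - complex_of_real t)))\<^sup>2) \<le> (1 / Im z)\<^sup>2"
    using norm_resolvent_le[OF assms] by (auto intro!: power_mono simp del: norm_divide power_divide)
qed measurable

text \<open>
  The imaginary part of the Cauchy transform is, up to the factor \<open>- Im z\<close>, the second moment of the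
  resolvent \<open>X = 1 / (z - t)\<close> regarded as a complex random variable.  Together with
  \<open>E X = G z\<close> this turns statements about \<open>Im F\<close> into statements about the variance of \<open>X\<close>.
\<close>

lemma Im_cauchy_transform:
  assumes "Im z > 0"
  shows "Im (cauchy_transform M z) = - Im z * expectation (\<lambda>t. (cmod (1 / (z - complex_of_real t)))\<^sup>2)"
proof -
  have "Im (cauchy_transform M z) = (\<integral>t. Im (1 / (z - complex_of_real t)) \<partial>M)"
    unfolding cauchy_transform_def using integrable_resolvent[OF assms] by (rule integral_Im[symmetric])
  also have "\<dots> = (\<integral>t. - Im z * (cmod (1 / (z - complex_of_real t)))\<^sup>2 \<partial>M)"
    by (rule Bochner_Integration.integral_cong) (simp_all only: Im_inverse_complex minus_complex.simps Im_complex_of_real diff_zero)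
  finally show ?thesis
    by simp
qed

lemma variance_resolvent:
  assumes "Im z > 0"
  defines "G \<equiv> cauchy_transform M z"
  shows "expectation (\<lambda>t. (cmod (1 / (z - complex_of_real t) - G))\<^sup>2)
    = expectation (\<lambda>t. (cmod (1 / (z - complex_of_real t)))\<^sup>2) - (cmod G)\<^sup>2"
    and "integrable M (\<lambda>t. (cmod (1 / (z - complex_of_real t) - G))\<^sup>2)"
proof -
  let ?f = "\<lambda>t. 1 / (z - complex_of_real t)"
  note int = integrable_resolvent[OF assms(1)] integrable_resolvent_power2[OF assms(1)]
  have I: "integrable M (\<lambda>t. Re (?f t * cnj G))"
    using int(1) by (intro integrable_Re integrable_mult_left) auto
  show "integrable M (\<lambda>t. (cmod (?f t - G))\<^sup>2)"
    unfolding cmod_diff_power2 using int I by (intro Bochner_Integration.integrable_add Bochner_Integration.integrable_diff integrable_mult_right) auto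
  have E: "expectation (\<lambda>t. Re (?f t * cnj G)) = (cmod G)\<^sup>2"
  proof -
    have "expectation (\<lambda>t. Re (?f t * cnj G)) = Re (\<integral>t. ?f t * cnj G \<partial>M)"
      using int(1) by (intro integral_Re integrable_mult_left) auto
    also have "(\<integral>t. ?f t * cnj G \<partial>M) = G * cnj G"
      unfolding G_def cauchy_transform_def by (rule integral_mult_left_zero)
    finally show ?thesis
      by (simp add: complex_norm_square[symmetric] cmod_power2 power2_eq_square)
  qed
  have "expectation (\<lambda>t. (cmod (?f t - G))\<^sup>2)
      = expectation (\<lambda>t. (cmod (?f t))\<^sup>2) - 2 * expectation (\<lambda>t. Re (?f t * cnj G)) + (cmod G)\<^sup>2"
    unfolding cmod_diff_power2 using int I
    using prob_space by (simp del: norm_divide)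
  then show "expectation (\<lambda>t. (cmod (?f t - G))\<^sup>2) = expectation (\<lambda>t. (cmod (?f t))\<^sup>2) - (cmod G)\<^sup>2"
    unfolding E by simp
qed

lemma Im_cauchy_transform_neg:
  assumes "Im z > 0"
  shows "Im (cauchy_transform M z) < 0"
proof -
  have "expectation (\<lambda>t. (cmod (1 / (z - complex_of_real t)))\<^sup>2) > 0"
  proof (rule ccontr)
    assume "\<not> ?thesis"
    moreover have "expectation (\<lambda>t. (cmod (1 / (z - complex_of_real t)))\<^sup>2) \<ge> 0"
      by (intro integral_nonneg_AE) auto
    ultimately have "expectation (\<lambda>t. (cmod (1 / (z - complex_of_real t)))\<^sup>2) = 0"
      by linarith
    then have "AE t in M. (cmod (1 / (z - complex_of_real t)))\<^sup>2 = 0"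
      using integral_nonneg_eq_0_iff_AE[OF integrable_resolvent_power2[OF assms]] by auto
    then have "AE t in M. False"
      by (rule AE_mp) (use resolvent_nonzero[OF assms] in auto)
    then show False
      using AE_False prob_space_axioms by (simp add: prob_space.emeasure_space_1)
  qed
  then show ?thesis
    using assms by (simp add: Im_cauchy_transform)
qed

lemma cauchy_transform_nonzero: "Im z > 0 \<Longrightarrow> cauchy_transform M z \<noteq> 0"
  using Im_cauchy_transform_neg[of z] by auto

lemma cauchy_transform_has_field_derivative:
  assumes z: "Im z > 0"
  shows "(cauchy_transform M has_field_derivative (\<integral>t. - (1 / (z - complex_of_real t))\<^sup>2 \<partial>M)) (at z)"
  unfolding has_field_derivative_iff tendsto_at_iff_sequentially comp_def
proof (intro allI impI)
  fix X :: "nat \<Rightarrow> complex"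
  assume X: "\<forall>i. X i \<in> UNIV - {z}" and lim: "X \<longlonglongrightarrow> z"
  have "(\<lambda>n. Im (X n)) \<longlonglongrightarrow> Im z"
    using lim by (intro tendsto_intros)
  then have "eventually (\<lambda>n. Im (X n) > Im z / 2) sequentially"
    by (rule order_tendstoD(1)) (use z in auto)
  then obtain N where N: "\<And>n. n \<ge> N \<Longrightarrow> Im (X n) > Im z / 2"
    by (auto simp: eventually_sequentially)
  let ?q = "\<lambda>n t. - (1 / (X n - complex_of_real t)) * (1 / (z - complex_of_real t))"
  have quot: "(cauchy_transform M (X n) - cauchy_transform M z) / (X n - z) = (\<integral>t. ?q n t \<partial>M)" if "n \<ge> N" for n
  proof -
    have pos: "Im (X n) > 0"
      using N[OF that] z by auto
    have "cauchy_transform M (X n) - cauchy_transform M z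
        = (\<integral>t. 1 / (X n - complex_of_real t) - 1 / (z - complex_of_real t) \<partial>M)"
      unfolding cauchy_transform_def
      using integrable_resolvent[OF pos] integrable_resolvent[OF z] by simp
    also have "\<dots> = (\<integral>t. (X n - z) * ?q n t \<partial>M)"
      by (intro Bochner_Integration.integral_cong refl)
         (simp only: inverse_diff_inverse_complex[OF resolvent_nonzero[OF pos] resolvent_nonzero[OF z]] diff_diff_eq2 diff_add_cancel)
    also have "\<dots> = (X n - z) * (\<integral>t. ?q n t \<partial>M)"
      by (rule integral_mult_right_zero)
    finally show ?thesis
      using X by simp
  qed
  have "(\<lambda>n. \<integral>t. ?q (n + N) t \<partial>M) \<longlonglongrightarrow> (\<integral>t. - (1 / (z - complex_of_real t))\<^sup>2 \<partial>M)"
  proof (rule integral_dominated_convergence[where w = "\<lambda>_. 2 / Im z * (1 / Im z)"])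
    show "AE t in M. (\<lambda>n. ?q (n + N) t) \<longlonglongrightarrow> - (1 / (z - complex_of_real t))\<^sup>2"
      using resolvent_nonzero[OF z]
      unfolding power2_eq_square mult_minus_left[symmetric]
      by (intro AE_I2 tendsto_intros LIMSEQ_ignore_initial_segment[OF lim]) auto
    show "AE t in M. norm (?q (n + N) t) \<le> 2 / Im z * (1 / Im z)" for n
    proof (rule AE_I2)
      fix t
      have "norm (1 / (X (n + N) - complex_of_real t)) \<le> 2 / Im z"
      proof -
        have "norm (1 / (X (n + N) - complex_of_real t)) \<le> 1 / Im (X (n + N))"
          using N[of "n + N"] z by (intro norm_resolvent_le) auto
        also have "\<dots> \<le> 1 / (Im z / 2)"
          using N[of "n + N"] z by (intro divide_left_mono) auto
        finally show ?thesis by simp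
      qed
      then show "norm (?q (n + N) t) \<le> 2 / Im z * (1 / Im z)"
        unfolding norm_mult norm_minus_cancel
        using norm_resolvent_le[OF z, of t] z by (intro mult_mono) (auto simp del: norm_divide)
    qed
  qed auto
  then have "(\<lambda>n. (cauchy_transform M (X (n + N)) - cauchy_transform M z) / (X (n + N) - z))
      \<longlonglongrightarrow> (\<integral>t. - (1 / (z - complex_of_real t))\<^sup>2 \<partial>M)"
    using quot by simp
  then show "(\<lambda>n. (cauchy_transform M (X n) - cauchy_transform M z) / (X n - z))
      \<longlonglongrightarrow> (\<integral>t. - (1 / (z - complex_of_real t))\<^sup>2 \<partial>M)"
    by (rule LIMSEQ_offset)
qed

lemma cauchy_transform_holomorphic: "cauchy_transform M holomorphic_on half_plane 0"
  unfolding holomorphic_on_open[OF open_half_plane]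
  by (intro ballI exI, rule cauchy_transform_has_field_derivative) simp

lemma F_transform_holomorphic: "F_transform M holomorphic_on half_plane 0"
  unfolding F_transform_def[abs_def]
  by (intro holomorphic_intros cauchy_transform_holomorphic) (simp add: cauchy_transform_nonzero)

text \<open>
  Since \<open>Im (1 / G) = - Im G / \<bar>G\<bar>\<^sup>2\<close> and \<open>- Im G / Im z\<close> is the second moment of the resolvent, the
  excess of \<open>Im (F z)\<close> over \<open>Im z\<close> is a multiple of the variance of the resolvent.
\<close>

lemma Im_F_transform:
  assumes "Im z > 0"
  shows "Im (F_transform M z) - Im z
    = Im z * expectation (\<lambda>t. (cmod (1 / (z - complex_of_real t) - cauchy_transform M z))\<^sup>2)
        / (cmod (cauchy_transform M z))\<^sup>2"
proof -
  let ?G = "cauchy_transform M z"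
  have "Im (F_transform M z) = - Im ?G / (cmod ?G)\<^sup>2"
    unfolding F_transform_def by (simp add: Im_divide cmod_power2)
  then show ?thesis
    using cauchy_transform_nonzero[OF assms]
    by (simp add: variance_resolvent[OF assms] Im_cauchy_transform[OF assms] field_simps)
qed

lemma Im_F_transform_ge:
  assumes "Im z > 0"
  shows "Im (F_transform M z) \<ge> Im z"
proof -
  have "Im (F_transform M z) - Im z \<ge> 0"
    unfolding Im_F_transform[OF assms] using assms
    by (intro divide_nonneg_nonneg mult_nonneg_nonneg integral_nonneg_AE) auto
  then show ?thesis by simp
qed

text \<open>
  For finite variance, \<open>F\<close> is a translation up to an error \<open>O(1 / Im w)\<close>, with the variance as constant.
  With \<open>f = 1 / (w - x)\<close> one has \<open>(w - m) G - 1 = E ((x - m) f) = E ((x - m) (f - G))\<close>.  By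
  Cauchy-Schwarz this is controlled by the variance of \<open>x\<close> and the variance of \<open>f\<close>, and the latter is
  \<open>\<bar>G\<bar>\<^sup>2 (Im F - Im w) / Im w\<close>, itself bounded by the distance \<open>d\<close> that is being estimated.  The
  inequality then reads \<open>d\<^sup>2 \<le> d \<sigma>\<^sup>2 / Im w\<close>, and one factor \<open>d\<close> cancels.
\<close>

lemma F_transform_near_shift:
  assumes sq: "integrable M (\<lambda>x. x\<^sup>2)" and w: "Im w > 0"
  defines "m \<equiv> expectation (\<lambda>x. x)"
  shows "cmod (w - complex_of_real m - F_transform M w) \<le> variance (\<lambda>x. x) / Im w"
proof -
  let ?G = "cauchy_transform M w" and ?f = "\<lambda>t. 1 / (w - complex_of_real t)"
  let ?V = "expectation (\<lambda>t. (cmod (?f t - ?G))\<^sup>2)"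
  define d where "d = cmod (w - complex_of_real m - F_transform M w)"
  have G0: "?G \<noteq> 0"
    by (rule cauchy_transform_nonzero[OF w])
  have intX: "integrable M (\<lambda>x. x)"
    by (rule square_integrable_imp_integrable) (use sq in auto)
  have intX2: "integrable M (\<lambda>x. (x - m)\<^sup>2)"
    unfolding power2_diff using sq intX by (intro Bochner_Integration.integrable_add Bochner_Integration.integrable_diff integrable_mult_left integrable_mult_right) auto
  have intf: "integrable M ?f"
    by (rule integrable_resolvent[OF w])
  have intV: "integrable M (\<lambda>t. (cmod (?f t - ?G))\<^sup>2)"
    by (rule variance_resolvent(2)[OF w])
  \<comment> \<open>Weight in the inequality between arithmetic and geometric mean; this choice makes the variance of the resolvent contribute at most half of \<open>d \<bar>G\<bar>\<close>.\<close>
  define l where "l = cmod ?G / Im w"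
  have l: "l > 0"
    using G0 w by (simp add: l_def)
  have pt: "\<bar>x - m\<bar> * cmod (?f x - ?G) \<le> (l * (x - m)\<^sup>2 + (cmod (?f x - ?G))\<^sup>2 / l) / 2" for x
  proof -
    have "0 \<le> (l * \<bar>x - m\<bar> - cmod (?f x - ?G))\<^sup>2 / (2 * l)"
      using l by simp
    also have "\<dots> = (l * (x - m)\<^sup>2 + (cmod (?f x - ?G))\<^sup>2 / l) / 2 - \<bar>x - m\<bar> * cmod (?f x - ?G)"
      using l unfolding power2_diff by (simp add: power_mult_distrib field_simps power2_eq_square)
    finally show ?thesis by simp
  qed
  have intXf: "integrable M (\<lambda>x. complex_of_real (x - m) * ?f x)"
  proof (rule Bochner_Integration.integrable_bound[of M "\<lambda>x. (x - m) * (1 / Im w)"])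
    show "integrable M (\<lambda>x. (x - m) * (1 / Im w))"
      using intX by (intro integrable_mult_left Bochner_Integration.integrable_diff) auto
    show "AE x in M. norm (complex_of_real (x - m) * ?f x) \<le> norm ((x - m) * (1 / Im w))"
      using norm_resolvent_le[OF w] w unfolding norm_mult
      by (intro AE_I2 mult_mono) (auto simp del: norm_divide)
  qed measurable
  have key: "(w - complex_of_real m) * ?G - 1 = (\<integral>x. complex_of_real (x - m) * (?f x - ?G) \<partial>M)"
  proof -
    have mean0: "(\<integral>x. complex_of_real (x - m) \<partial>M) = 0"
      using intX prob_space by (simp add: m_def del: of_real_diff)
    have "(\<integral>x. complex_of_real (x - m) * (?f x - ?G) \<partial>M)
        = (\<integral>x. complex_of_real (x - m) * ?f x - complex_of_real (x - m) * ?G \<partial>M)"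
      by (simp add: algebra_simps)
    also have "\<dots> = (\<integral>x. complex_of_real (x - m) * ?f x \<partial>M) - (\<integral>x. complex_of_real (x - m) * ?G \<partial>M)"
      using intXf intX
      by (intro Bochner_Integration.integral_diff integrable_mult_left integrable_of_real Bochner_Integration.integrable_diff) auto
    also have "(\<integral>x. complex_of_real (x - m) * ?G \<partial>M) = 0"
      by (simp only: integral_mult_left_zero mean0 mult_zero_left)
    also have "(\<integral>x. complex_of_real (x - m) * ?f x \<partial>M) = (\<integral>x. (w - complex_of_real m) * ?f x - 1 \<partial>M)"
      using resolvent_nonzero[OF w]
      by (intro Bochner_Integration.integral_cong refl) (simp add: field_simps)
    also have "\<dots> = (w - complex_of_real m) * ?G - 1"
      using intf prob_space unfolding cauchy_transform_def
      by (subst Bochner_Integration.integral_diff) (auto intro!: integrable_mult_right simp del: times_divide_eq_right)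
    finally show ?thesis by simp
  qed
  have "d * cmod ?G = cmod ((w - complex_of_real m) * ?G - 1)"
    using G0 unfolding d_def norm_mult[symmetric] by (simp add: F_transform_def left_diff_distrib)
  also have "\<dots> \<le> (\<integral>x. cmod (complex_of_real (x - m) * (?f x - ?G)) \<partial>M)"
    unfolding key by (rule integral_norm_bound)
  also have "\<dots> \<le> (\<integral>x. (l * (x - m)\<^sup>2 + (cmod (?f x - ?G))\<^sup>2 / l) / 2 \<partial>M)"
    using pt intX2 intV l
    by (intro integral_mono_AE' AE_I2)
       (simp_all add: norm_mult del: of_real_diff norm_divide)
  also have "\<dots> = (l * variance (\<lambda>x. x) + ?V / l) / 2"
    using intX2 intV by (simp add: m_def)
  also have "?V = (cmod ?G)\<^sup>2 * (Im (F_transform M w) - Im w) / Im w"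
    using G0 w by (simp add: Im_F_transform[OF w] field_simps)
  finally have "d * cmod ?G \<le> (l * variance (\<lambda>x. x) + (cmod ?G)\<^sup>2 * (Im (F_transform M w) - Im w) / Im w / l) / 2" .
  also have "\<dots> = cmod ?G * ((variance (\<lambda>x. x) / Im w + (Im (F_transform M w) - Im w)) / 2)"
    using G0 w unfolding l_def by (simp add: field_simps power2_eq_square)
  finally have "d \<le> (variance (\<lambda>x. x) / Im w + (Im (F_transform M w) - Im w)) / 2"
    using G0 by (simp add: mult.commute)
  moreover have "Im (F_transform M w) - Im w \<le> d"
    using abs_Im_le_cmod[of "w - complex_of_real m - F_transform M w"] unfolding d_def by simp
  ultimately show ?thesis
    unfolding d_def by simp
qed

text \<open>
  In a cone \<open>\<bar>z / (z - t)\<bar>\<close> is bounded independently of \<open>t\<close>, so \<open>z G z \<rightarrow> 1\<close> by dominated convergence, for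
  an arbitrary probability measure.  A sequence of counterexamples tending to infinity contradicts this.
\<close>

lemma F_transform_asymptotic:
  assumes "\<alpha> > 0" "\<epsilon> > 0"
  shows "\<exists>\<beta>>0. \<forall>z\<in>truncated_cone \<alpha> \<beta>. cmod (F_transform M z - z) \<le> \<epsilon> * cmod z"
proof (rule ccontr)
  assume contra: "\<not> ?thesis"
  have "\<exists>z. z \<in> truncated_cone \<alpha> (real (Suc n)) \<and> cmod (F_transform M z - z) > \<epsilon> * cmod z" for n
  proof -
    have "\<not> (\<forall>z\<in>truncated_cone \<alpha> (real (Suc n)). cmod (F_transform M z - z) \<le> \<epsilon> * cmod z)"
      using contra of_nat_0_less_iff zero_less_Suc by blast
    then show ?thesis
      by (auto simp only: Ball_def not_all not_imp not_le)
  qed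
  then obtain X where X: "\<And>n. X n \<in> truncated_cone \<alpha> (real (Suc n))"
    "\<And>n. cmod (F_transform M (X n) - X n) > \<epsilon> * cmod (X n)"
    by metis
  have Im: "Im (X n) > real (Suc n)" for n
    using X(1)[of n] by (simp add: truncated_cone_def)
  have pos: "Im (X n) > 0" for n
    using Im[of n] by linarith
  have nz: "X n \<noteq> 0" for n
    using pos[of n] by auto
  have bound: "norm (X n / (X n - complex_of_real t)) \<le> \<alpha> + 1" for n t
  proof -
    have "cmod (X n) \<le> (\<alpha> + 1) * Im (X n)"
      using cmod_le[of "X n"] X(1)[of n] pos[of n] by (simp add: truncated_cone_def algebra_simps)
    moreover have "norm (X n / (X n - complex_of_real t)) = cmod (X n) * cmod (1 / (X n - complex_of_real t))"
      by (simp add: norm_divide)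
    moreover have "\<dots> \<le> ((\<alpha> + 1) * Im (X n)) * (1 / Im (X n))"
      using calculation(1) norm_resolvent_le[OF pos, of n t] pos[of n] assms
      by (intro mult_mono) (auto simp del: norm_divide)
    ultimately show ?thesis
      using pos[of n] by simp
  qed
  have "(\<lambda>n. \<integral>t. X n / (X n - complex_of_real t) \<partial>M) \<longlonglongrightarrow> (\<integral>t. 1 \<partial>M)"
  proof (rule integral_dominated_convergence[where w = "\<lambda>_. \<alpha> + 1"])
    show "AE t in M. (\<lambda>n. X n / (X n - complex_of_real t)) \<longlonglongrightarrow> 1"
    proof (rule AE_I2)
      fix t
      have "(\<lambda>n. complex_of_real t / (X n - complex_of_real t)) \<longlonglongrightarrow> 0"
      proof (rule Lim_null_comparison)
        show "eventually (\<lambda>n. norm (complex_of_real t / (X n - complex_of_real t)) \<le> \<bar>t\<bar> * (1 / real (Suc n))) sequentially"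
        proof (rule always_eventually, rule allI)
          fix n
          have "norm (1 / (X n - complex_of_real t)) \<le> 1 / real (Suc n)"
            using norm_resolvent_le[OF pos, of n t] Im[of n]
            by (smt (verit) frac_le of_nat_0_less_iff zero_less_Suc)
          then show "norm (complex_of_real t / (X n - complex_of_real t)) \<le> \<bar>t\<bar> * (1 / real (Suc n))"
            using mult_left_mono[of _ _ "\<bar>t\<bar>"] by (fastforce simp: norm_divide)
        qed
        show "(\<lambda>n. \<bar>t\<bar> * (1 / real (Suc n))) \<longlonglongrightarrow> 0"
          by (rule tendsto_mult_right_zero) (rule lim_1_over_n[THEN LIMSEQ_Suc])
      qed
      then have "(\<lambda>n. 1 + complex_of_real t / (X n - complex_of_real t)) \<longlonglongrightarrow> 1 + 0"
        by (intro tendsto_intros)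
      then show "(\<lambda>n. X n / (X n - complex_of_real t)) \<longlonglongrightarrow> 1"
        using resolvent_nonzero[OF pos] by (simp add: field_simps)
    qed
  qed (use bound in auto)
  then have "(\<lambda>n. X n * cauchy_transform M (X n)) \<longlonglongrightarrow> 1"
    using prob_space unfolding cauchy_transform_def
    by (simp flip: integral_mult_right_zero)
  then have "(\<lambda>n. 1 / (X n * cauchy_transform M (X n)) - 1) \<longlonglongrightarrow> 1 / 1 - 1"
    by (intro tendsto_intros) auto
  then have "(\<lambda>n. cmod (1 / (X n * cauchy_transform M (X n)) - 1)) \<longlonglongrightarrow> 0"
    using tendsto_norm by fastforce
  then have "eventually (\<lambda>n. cmod (1 / (X n * cauchy_transform M (X n)) - 1) < \<epsilon>) sequentially"
    by (rule order_tendstoD(2)) (use assms in auto)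
  then obtain n where n: "cmod (1 / (X n * cauchy_transform M (X n)) - 1) < \<epsilon>"
    by (auto simp: eventually_sequentially)
  have "F_transform M (X n) - X n = X n * (1 / (X n * cauchy_transform M (X n)) - 1)"
    using nz[of n] by (simp add: F_transform_def right_diff_distrib)
  then have "cmod (F_transform M (X n) - X n) \<le> \<epsilon> * cmod (X n)"
    using mult_left_mono[OF less_imp_le[OF n], of "cmod (X n)"] by (simp only: norm_mult norm_ge_zero mult.commute)
  with X(2)[of n] show False by simp
qed

end

section \<open>Integral representation in the upper half-plane\<close>

lemma integrable_lborel_inverse_1_plus_square: "integrable lborel (\<lambda>t::real. 1 / (1 + t\<^sup>2))"
  using integrable_inverse_1_plus_square by (simp add: set_integrable_def inverse_eq_divide)

text \<open>
  Only the bottom side of the rectangle with corners \<open>- R\<close> and \<open>R + i R\<close> survives as \<open>R \<rightarrow> \<infinity>\<close>: on the other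
  sides the integrand is \<open>O(1 / R\<^sup>2)\<close> while their length is \<open>4 R\<close>.
\<close>

lemma integral_over_real_line_from_rectangles:
  fixes G :: "complex \<Rightarrow> complex"
  assumes eps: "\<epsilon> > 0"
    and G: "G holomorphic_on half_plane (- \<epsilon>)"
    and bound: "\<And>\<zeta>. Im \<zeta> \<ge> 0 \<Longrightarrow> cmod (G \<zeta>) * (1 + cmod \<zeta>) \<le> C"
    and p: "Im p \<noteq> 0"
    and rect: "\<And>R. R \<ge> R0 \<Longrightarrow>
      ((\<lambda>\<zeta>. G \<zeta> / (\<zeta> - p)) has_contour_integral c) (rectpath (- of_real R) (Complex R R))"
  shows "integrable lborel (\<lambda>t. G (of_real t) / (of_real t - p))" (is "integrable _ ?f")
    and "c = (LINT t|lborel. G (of_real t) / (of_real t - p))"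
proof -
  let ?g = "\<lambda>\<zeta>. G \<zeta> / (\<zeta> - p)"
  have contG: "continuous_on {\<zeta>. Im \<zeta> \<ge> 0} G"
    using holomorphic_on_imp_continuous_on[OF G] by (rule continuous_on_subset) (use eps in auto)
  have C0: "C \<ge> 0"
    using bound[of 0] by (smt (verit) mult_nonneg_nonneg norm_ge_zero zero_complex.simps)
  have contf: "continuous_on UNIV ?f"
    using p by (intro continuous_intros continuous_on_compose2[OF contG]) auto
  \<comment> \<open>The distance from \<open>t\<close> to the pole is bounded below by a multiple of \<open>1 + \<bar>t\<bar>\<close>, because the pole is off the real line.\<close>
  define k where "k = (1 + cmod p) / \<bar>Im p\<bar> + 1"
  have k: "1 + \<bar>t\<bar> \<le> k * cmod (of_real t - p)" for t :: real
  proof -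
    have "\<bar>Im p\<bar> \<le> cmod (of_real t - p)"
      using abs_Im_le_cmod[of "of_real t - p"] by simp
    then have "1 + cmod p \<le> (1 + cmod p) / \<bar>Im p\<bar> * cmod (of_real t - p)"
      using p by (simp add: pos_le_divide_eq mult_left_mono)
    moreover have "\<bar>t\<bar> \<le> cmod p + cmod (of_real t - p)"
      using norm_triangle_ineq[of p "of_real t - p"] by simp
    ultimately show ?thesis
      unfolding k_def by (simp add: algebra_simps)
  qed
  have k0: "k > 0"
    unfolding k_def by (smt (verit) divide_nonneg_nonneg norm_ge_zero abs_ge_zero)
  have fle: "cmod (?f t) \<le> C * k * (1 / (1 + t\<^sup>2))" for t
  proof -
    have pos: "1 + \<bar>t\<bar> > 0" "cmod (of_real t - p) > 0"
      using p by (auto simp: complex_eq_iff)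
    have "cmod (G (of_real t)) \<le> C / (1 + \<bar>t\<bar>)"
      using bound[of "of_real t"] pos by (simp add: pos_le_divide_eq)
    moreover have "1 / cmod (of_real t - p) \<le> k / (1 + \<bar>t\<bar>)"
      using k[of t] pos by (simp add: field_simps)
    ultimately have "cmod (G (of_real t)) * (1 / cmod (of_real t - p)) \<le> C / (1 + \<bar>t\<bar>) * (k / (1 + \<bar>t\<bar>))"
      using C0 pos by (intro mult_mono) auto
    also have "\<dots> = C * k / (1 + \<bar>t\<bar>)\<^sup>2"
      by (simp add: power2_eq_square)
    also have "\<dots> \<le> C * k / (1 + t\<^sup>2)"
      using C0 k0 by (intro divide_left_mono) (auto simp: power2_sum intro!: mult_pos_pos add_pos_nonneg)
    finally show ?thesis
      by (simp add: norm_divide)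
  qed
  show int: "integrable lborel ?f"
  proof (rule Bochner_Integration.integrable_bound)
    show "integrable lborel (\<lambda>t. C * k * (1 / (1 + t\<^sup>2)))"
      using integrable_lborel_inverse_1_plus_square by (rule integrable_mult_right)
    show "?f \<in> borel_measurable lborel"
      using borel_measurable_continuous_onI[OF contf] by simp
    show "AE t in lborel. norm (?f t) \<le> norm (C * k * (1 / (1 + t\<^sup>2)))"
      using fle by (intro AE_I2) (smt (verit) real_norm_def)
  qed
  have est: "cmod (c - (LINT t:{-R..R}|lborel. ?f t)) \<le> 8 * C / R" if R: "R \<ge> R0" "R > 0" "R \<ge> 2 * cmod p" for R
  proof -
    let ?a1 = "- complex_of_real R" and ?a2 = "complex_of_real R" and ?a3 = "Complex R R" and ?a4 = "Complex (-R) R"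
    have big: "cmod (?g \<zeta>) \<le> 2 * C / R\<^sup>2" if "Im \<zeta> \<ge> 0" "cmod \<zeta> \<ge> R" for \<zeta>
    proof -
      have "cmod (G \<zeta>) \<le> C / R"
      proof -
        have "cmod (G \<zeta>) * R \<le> cmod (G \<zeta>) * (1 + cmod \<zeta>)"
          using that by (intro mult_left_mono) auto
        then show ?thesis
          using bound[OF that(1)] R by (simp add: pos_le_divide_eq)
      qed
      moreover have "cmod (\<zeta> - p) \<ge> R / 2"
        using norm_triangle_ineq2[of \<zeta> p] that R by simp
      ultimately have "cmod (G \<zeta>) / cmod (\<zeta> - p) \<le> (C / R) / (R / 2)"
        using C0 R by (intro frac_le) auto
      then show ?thesis
        by (simp add: norm_divide power2_eq_square field_simps)
    qed
    have "Re \<zeta> = R \<and> Im \<zeta> \<ge> 0" if "\<zeta> \<in> closed_segment ?a2 ?a3" for \<zeta>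
      using that R by (auto simp: closed_segment_def) (simp_all add: algebra_simps)
    moreover have "Im \<zeta> = R" if "\<zeta> \<in> closed_segment ?a3 ?a4" for \<zeta>
      using that R by (auto simp: closed_segment_def) (simp_all add: algebra_simps)
    moreover have "Re \<zeta> = - R \<and> Im \<zeta> \<ge> 0" if "\<zeta> \<in> closed_segment ?a4 ?a1" for \<zeta>
      using that R by (auto simp: closed_segment_def) (simp_all add: algebra_simps)
    ultimately have seg: "Re \<zeta> = R \<or> Im \<zeta> = R \<or> Re \<zeta> = - R" "Im \<zeta> \<ge> 0"
      if "\<zeta> \<in> closed_segment ?a2 ?a3 \<or> \<zeta> \<in> closed_segment ?a3 ?a4 \<or> \<zeta> \<in> closed_segment ?a4 ?a1" for \<zeta>
      using that R by (fastforce, smt (verit, best))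
    have segbig: "cmod \<zeta> \<ge> R" if "Re \<zeta> = R \<or> Im \<zeta> = R \<or> Re \<zeta> = - R" for \<zeta>
      using that abs_Re_le_cmod[of \<zeta>] abs_Im_le_cmod[of \<zeta>] by auto
    have contg: "continuous_on ({\<zeta>. Im \<zeta> \<ge> 0} - {p}) ?g"
      by (intro continuous_intros continuous_on_subset[OF contG]) auto
    have i1: "?g contour_integrable_on linepath ?a1 ?a2"
      using p by (intro contour_integrable_continuous_linepath continuous_on_subset[OF contg])
        (auto simp: closed_segment_def)
    have ne: "\<zeta> \<noteq> p" if "cmod \<zeta> \<ge> R" for \<zeta>
      using that R by auto
    have i2: "?g contour_integrable_on linepath ?a2 ?a3"
      and i3: "?g contour_integrable_on linepath ?a3 ?a4"
      and i4: "?g contour_integrable_on linepath ?a4 ?a1"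
      using seg segbig ne
      by (intro contour_integrable_continuous_linepath continuous_on_subset[OF contg]; blast)+
    have path: "rectpath ?a1 ?a3 = linepath ?a1 ?a2 +++ linepath ?a2 ?a3 +++ linepath ?a3 ?a4 +++ linepath ?a4 ?a1"
      by (simp add: rectpath_def Let_def complex_of_real_def)
    have "(?g has_contour_integral (contour_integral (linepath ?a1 ?a2) ?g + (contour_integral (linepath ?a2 ?a3) ?g
        + (contour_integral (linepath ?a3 ?a4) ?g + contour_integral (linepath ?a4 ?a1) ?g)))) (rectpath ?a1 ?a3)"
      unfolding path using i1 i2 i3 i4
      by (intro has_contour_integral_join has_contour_integral_integral) auto
    then have c: "c = contour_integral (linepath ?a1 ?a2) ?g + (contour_integral (linepath ?a2 ?a3) ?g
        + (contour_integral (linepath ?a3 ?a4) ?g + contour_integral (linepath ?a4 ?a1) ?g))"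
      using has_contour_integral_unique rect[OF R(1)] by blast
    have "contour_integral (linepath ?a1 ?a2) ?g = integral {-R..R} ?f"
      using contour_integral_linepath_Reals_eq[of ?a1 ?a2 ?g] R by simp
    also have "\<dots> = (LINT t:{-R..R}|lborel. ?f t)"
      by (rule set_borel_integral_eq_integral(2)[symmetric])
         (rule set_integrable_subset[where A = UNIV]; use int in \<open>simp add: set_integrable_def\<close>)
    finally have bot: "contour_integral (linepath ?a1 ?a2) ?g = (LINT t:{-R..R}|lborel. ?f t)" .
    have B0: "0 \<le> 2 * C / R\<^sup>2"
      using C0 by simp
    have "cmod (contour_integral (linepath ?a2 ?a3) ?g) \<le> 2 * C / R\<^sup>2 * cmod (?a3 - ?a2)"
      using seg segbig big by (intro contour_integral_bound_linepath[OF i2 B0]) blast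
    moreover have "cmod (contour_integral (linepath ?a3 ?a4) ?g) \<le> 2 * C / R\<^sup>2 * cmod (?a4 - ?a3)"
      using seg segbig big by (intro contour_integral_bound_linepath[OF i3 B0]) blast
    moreover have "cmod (contour_integral (linepath ?a4 ?a1) ?g) \<le> 2 * C / R\<^sup>2 * cmod (?a1 - ?a4)"
      using seg segbig big by (intro contour_integral_bound_linepath[OF i4 B0]) blast
    moreover have "cmod (?a3 - ?a2) = R" "cmod (?a4 - ?a3) = 2 * R" "cmod (?a1 - ?a4) = R"
      using R by (simp_all add: cmod_def real_sqrt_mult)
    ultimately have "cmod (contour_integral (linepath ?a2 ?a3) ?g + (contour_integral (linepath ?a3 ?a4) ?g
        + contour_integral (linepath ?a4 ?a1) ?g)) \<le> 2 * C / R\<^sup>2 * R + (2 * C / R\<^sup>2 * (2 * R) + 2 * C / R\<^sup>2 * R)"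
      by (intro order_trans[OF norm_triangle_ineq] add_mono) auto
    also have "\<dots> = 8 * C / R"
      using R by (simp add: field_simps power2_eq_square)
    finally show ?thesis
      unfolding c bot by simp
  qed
  have lim1: "(\<lambda>n. LINT t:{-real n..real n}|lborel. ?f t) \<longlonglongrightarrow> (LINT t|lborel. ?f t)"
    unfolding set_lebesgue_integral_def
  proof (rule integral_dominated_convergence[where w = "\<lambda>t. norm (?f t)"])
    show "AE t in lborel. (\<lambda>n. indicator {-real n..real n} t *\<^sub>R ?f t) \<longlonglongrightarrow> ?f t"
    proof (rule AE_I2)
      fix t :: real
      obtain N :: nat where N: "\<bar>t\<bar> \<le> real N"
        using real_arch_simple by blast
      have "eventually (\<lambda>n. indicator {-real n..real n} t *\<^sub>R ?f t = ?f t) sequentially"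
        using eventually_ge_at_top[of N]
      proof eventually_elim
        case (elim n)
        then have "\<bar>t\<bar> \<le> real n"
          using N by linarith
        then have "t \<in> {-real n..real n}"
          by auto
        then show ?case by simp
      qed
      then show "(\<lambda>n. indicator {-real n..real n} t *\<^sub>R ?f t) \<longlonglongrightarrow> ?f t"
        by (rule tendsto_eventually)
    qed
  qed (use int in \<open>auto simp: indicator_def integrable_norm\<close>)
  have "(\<lambda>n. c - (LINT t:{-real n..real n}|lborel. ?f t)) \<longlonglongrightarrow> 0"
  proof (rule Lim_null_comparison)
    obtain N :: nat where N: "max R0 (max 1 (2 * cmod p)) \<le> real N"
      using real_arch_simple by blast
    show "eventually (\<lambda>n. norm (c - (LINT t:{-real n..real n}|lborel. ?f t)) \<le> 8 * C / real n) sequentially"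
      using eventually_ge_at_top[of N]
    proof eventually_elim
      case (elim n)
      then have "real N \<le> real n" by simp
      with N show ?case by (intro est) auto
    qed
    show "(\<lambda>n. 8 * C / real n) \<longlonglongrightarrow> 0"
      by (rule lim_const_over_n)
  qed
  then have "(\<lambda>n. LINT t:{-real n..real n}|lborel. ?f t) \<longlonglongrightarrow> c"
    using tendsto_diff[OF tendsto_const[of c]] by fastforce
  with lim1 show "c = (LINT t|lborel. ?f t)"
    using LIMSEQ_unique by blast
qed

text \<open>
  Cauchy's formula at \<open>z\<close> gives \<open>2 \<pi> i G z\<close> as an integral over the real line, and
  the same integral with the pole reflected to \<open>cnj z\<close> vanishes.  The conjugate of the second
  identity, subtracted from the first, replaces \<open>G\<close> on the line by \<open>G - cnj G = 2 i Im G\<close>.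
\<close>

lemma upper_half_plane_representation:
  fixes G :: "complex \<Rightarrow> complex"
  assumes eps: "\<epsilon> > 0"
    and G: "G holomorphic_on half_plane (- \<epsilon>)"
    and bound: "\<And>\<zeta>. Im \<zeta> \<ge> 0 \<Longrightarrow> cmod (G \<zeta>) * (1 + cmod \<zeta>) \<le> C"
    and z: "Im z > 0"
  shows "G z = (LINT t|lborel. of_real (- Im (G (of_real t)) / pi) / (z - of_real t))"
proof -
  define R0 where "R0 = 1 + \<bar>Re z\<bar> + Im z"
  have inbox: "z \<in> box (- complex_of_real R) (Complex R R)" if "R \<ge> R0" for R
    using that z by (auto simp: in_box_complex_iff R0_def)
  have sub: "path_image (rectpath (- complex_of_real R) (Complex R R)) \<subseteq> {\<zeta>. Im \<zeta> \<ge> 0} - {z}" if "R \<ge> R0" for R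
    using inbox[OF that] that z path_image_rectpath_cbox_minus_box[of "- complex_of_real R" "Complex R R"]
    by (auto simp: in_cbox_complex_iff R0_def)
  have J1: "((\<lambda>\<zeta>. G \<zeta> / (\<zeta> - z)) has_contour_integral (2 * pi * \<i> * G z)) (rectpath (- complex_of_real R) (Complex R R))"
    if "R \<ge> R0" for R
  proof -
    have "((\<lambda>\<zeta>. G \<zeta> / (\<zeta> - z)) has_contour_integral
        (2 * pi * \<i> * winding_number (rectpath (- complex_of_real R) (Complex R R)) z * G z)) (rectpath (- complex_of_real R) (Complex R R))"
    proof (rule Cauchy_integral_formula_convex_simple[OF convex_half_plane G])
      show "z \<in> interior (half_plane (- \<epsilon>))"
        using z eps by (simp add: interior_open open_half_plane)
      show "path_image (rectpath (- complex_of_real R) (Complex R R)) \<subseteq> half_plane (- \<epsilon>) - {z}"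
        using sub[OF that] eps by auto
    qed auto
    then show ?thesis
      by (simp add: winding_number_rectpath[OF inbox[OF that]])
  qed
  have J2: "((\<lambda>\<zeta>. G \<zeta> / (\<zeta> - cnj z)) has_contour_integral 0) (rectpath (- complex_of_real R) (Complex R R))"
    if "R \<ge> R0" for R
  proof (rule Cauchy_theorem_convex_simple)
    show "(\<lambda>\<zeta>. G \<zeta> / (\<zeta> - cnj z)) holomorphic_on half_plane (- min \<epsilon> (Im z))"
      by (intro holomorphic_intros holomorphic_on_subset[OF G]) auto
    show "path_image (rectpath (- complex_of_real R) (Complex R R)) \<subseteq> half_plane (- min \<epsilon> (Im z))"
      using sub[OF that] eps z by auto
  qed (auto simp: convex_half_plane)
  have z0: "Im z \<noteq> 0" "Im (cnj z) \<noteq> 0"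
    using z by auto
  note 1 = integral_over_real_line_from_rectangles[OF eps G bound z0(1) J1]
  note 2 = integral_over_real_line_from_rectangles[OF eps G bound z0(2) J2]
  have "0 = cnj (LINT t|lborel. G (of_real t) / (of_real t - cnj z))"
    using 2(2) by simp
  also have "\<dots> = (LINT t|lborel. cnj (G (of_real t) / (of_real t - cnj z)))"
    by (rule Bochner_Integration.integral_cnj[symmetric])
  also have "\<dots> = (LINT t|lborel. cnj (G (of_real t)) / (of_real t - z))"
    by simp
  finally have 3: "(LINT t|lborel. cnj (G (of_real t)) / (of_real t - z)) = 0"
    by simp
  have int3: "integrable lborel (\<lambda>t. cnj (G (of_real t)) / (of_real t - z))"
    using integrable_cnj[OF 2(1)] by simp
  have "2 * pi * \<i> * G z = (LINT t|lborel. G (of_real t) / (of_real t - z) - cnj (G (of_real t)) / (of_real t - z))"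
    using 1 3 int3 by simp
  also have "\<dots> = (LINT t|lborel. (2 * pi * \<i>) * (of_real (- Im (G (of_real t)) / pi) / (z - of_real t)))"
  proof (rule Bochner_Integration.integral_cong[OF refl])
    fix t :: real
    have "G (of_real t) - cnj (G (of_real t)) = (2 * pi * \<i>) * of_real (Im (G (of_real t)) / pi)"
      by (simp add: complex_diff_cnj)
    then have "G (of_real t) / (of_real t - z) - cnj (G (of_real t)) / (of_real t - z)
        = (2 * pi * \<i>) * of_real (Im (G (of_real t)) / pi) / (of_real t - z)"
      by (simp only: diff_divide_distrib[symmetric])
    also have "\<dots> = (2 * pi * \<i>) * (of_real (- Im (G (of_real t)) / pi) / (z - of_real t))"
      using resolvent_nonzero[OF z, of t] by (simp add: divide_simps) (simp add: algebra_simps)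
    finally show "G (of_real t) / (of_real t - z) - cnj (G (of_real t)) / (of_real t - z)
        = (2 * pi * \<i>) * (of_real (- Im (G (of_real t)) / pi) / (z - of_real t))" .
  qed
  also have "\<dots> = (2 * pi * \<i>) * (LINT t|lborel. of_real (- Im (G (of_real t)) / pi) / (z - of_real t))"
    by (rule integral_mult_right_zero)
  finally show ?thesis
    by (subst (asm) mult_left_cancel) simp_all
qed

section \<open>Functions that are F-transforms\<close>

text \<open>
  When \<open>F\<close> extends across the real line, the measure is explicit: Stieltjes inversion predicts the density
  \<open>- Im (1 / F) / \<pi>\<close>, and the integral representation of \<open>1 / F\<close> confirms it.  The bounds make this density
  \<open>O(1 / (1 + t\<^sup>2))\<close>; its mass is the limit of \<open>i y / F (i y)\<close>, which is \<open>1\<close>.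
\<close>

lemma measure_of_shifted_F_transform:
  fixes F :: "complex \<Rightarrow> complex"
  assumes eps: "\<epsilon> > 0"
    and F: "F holomorphic_on half_plane (- \<epsilon>)"
    and pos: "\<And>\<zeta>. Im \<zeta> > - \<epsilon> \<Longrightarrow> Im (F \<zeta>) > 0"
    and del: "\<delta> > 0" "\<And>\<zeta>. Im \<zeta> \<ge> 0 \<Longrightarrow> Im (F \<zeta>) \<ge> \<delta>"
    and K: "\<And>\<zeta>. Im \<zeta> \<ge> 0 \<Longrightarrow> cmod (F \<zeta> - \<zeta>) \<le> K"
  defines "p \<equiv> (\<lambda>t. - Im (1 / F (complex_of_real t)) / pi)"
  shows "real_distribution (density lborel (\<lambda>t. ennreal (p t)))"
    and "\<And>z. Im z > 0 \<Longrightarrow> F_transform (density lborel (\<lambda>t. ennreal (p t))) z = F z"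
proof -
  define G where "G \<zeta> = 1 / F \<zeta>" for \<zeta>
  have G: "G holomorphic_on half_plane (- \<epsilon>)"
    unfolding G_def using pos by (intro holomorphic_intros F) fastforce
  define C where "C = (1 + K) / \<delta> + 1"
  have K0: "K \<ge> 0"
    using K[of 0] by (smt (verit) norm_ge_zero zero_complex.simps)
  have FC: "1 + cmod \<zeta> \<le> C * cmod (F \<zeta>)" and Fd: "\<delta> \<le> cmod (F \<zeta>)" if "Im \<zeta> \<ge> 0" for \<zeta>
  proof -
    show Fd: "\<delta> \<le> cmod (F \<zeta>)"
      using del(2)[OF that] abs_Im_le_cmod[of "F \<zeta>"] by simp
    then have "1 + K \<le> (1 + K) / \<delta> * cmod (F \<zeta>)"
      using del(1) K0 by (simp add: pos_le_divide_eq mult_left_mono)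
    moreover have "cmod \<zeta> \<le> K + cmod (F \<zeta>)"
      using K[OF that] norm_triangle_ineq4[of "F \<zeta>" "F \<zeta> - \<zeta>"] by simp
    ultimately show "1 + cmod \<zeta> \<le> C * cmod (F \<zeta>)"
      unfolding C_def by (simp add: algebra_simps)
  qed
  have bound: "cmod (G \<zeta>) * (1 + cmod \<zeta>) \<le> C" if "Im \<zeta> \<ge> 0" for \<zeta>
  proof -
    have "cmod (F \<zeta>) > 0"
      using Fd[OF that] del(1) by linarith
    then show ?thesis
      using FC[OF that] by (simp add: G_def norm_divide pos_divide_le_eq)
  qed
  have rep: "G z = (LINT t|lborel. complex_of_real (p t) / (z - of_real t))" if "Im z > 0" for z
    using upper_half_plane_representation[OF eps G bound that] by (simp only: p_def G_def)
  have p_eq: "p t = Im (F (of_real t)) / (cmod (F (of_real t)))\<^sup>2 / pi" for t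
    unfolding p_def Im_inverse_complex by (simp add: norm_divide power_divide)
  have p0: "p t \<ge> 0" for t
    unfolding p_eq using pos[of "of_real t"] eps by simp
  have "F (complex_of_real t) \<noteq> 0" for t
  proof -
    have "cmod (F (complex_of_real t)) > 0"
      using less_le_trans[OF del(1) Fd] by simp
    then show ?thesis by simp
  qed
  then have "continuous_on UNIV p"
    unfolding p_def using eps
    by (intro continuous_intros continuous_on_compose2[OF holomorphic_on_imp_continuous_on[OF F]]) auto
  then have pm [measurable]: "p \<in> borel_measurable borel"
    by (rule borel_measurable_continuous_onI)
  have ple: "p t \<le> K * C\<^sup>2 / pi * (1 / (1 + t\<^sup>2))" for t
  proof -
    let ?F = "F (of_real t)"
    have F0: "cmod ?F > 0"
      using less_le_trans[OF del(1) Fd] by simp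
    have "Im ?F \<le> K"
      using K[of "of_real t"] abs_Im_le_cmod[of "?F - of_real t"] by simp
    moreover have "1 + t\<^sup>2 \<le> C\<^sup>2 * (cmod ?F)\<^sup>2"
    proof -
      have "1 + t\<^sup>2 \<le> (1 + \<bar>t\<bar>)\<^sup>2"
        by (simp add: power2_sum)
      also have "\<dots> \<le> (C * cmod ?F)\<^sup>2"
        using FC[of "of_real t"] by (intro power_mono) auto
      finally show ?thesis
        by (simp add: power_mult_distrib)
    qed
    then have "1 / (cmod ?F)\<^sup>2 \<le> C\<^sup>2 * (1 / (1 + t\<^sup>2))"
      using F0 by (simp add: divide_simps) (smt (verit) power2_less_0 zero_le_power2)
    ultimately have "Im ?F * (1 / (cmod ?F)\<^sup>2) \<le> K * (C\<^sup>2 * (1 / (1 + t\<^sup>2)))"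
      using K0 by (intro mult_mono) auto
    then have "Im ?F * (1 / (cmod ?F)\<^sup>2) / pi \<le> K * (C\<^sup>2 * (1 / (1 + t\<^sup>2))) / pi"
      by (rule divide_right_mono) simp
    then show ?thesis
      unfolding p_eq by (simp add: mult.commute)
  qed
  have intp: "integrable lborel p"
  proof (rule Bochner_Integration.integrable_bound)
    show "integrable lborel (\<lambda>t. K * C\<^sup>2 / pi * (1 / (1 + t\<^sup>2)))"
      using integrable_lborel_inverse_1_plus_square by (rule integrable_mult_right)
    show "AE t in lborel. norm (p t) \<le> norm (K * C\<^sup>2 / pi * (1 / (1 + t\<^sup>2)))"
      using ple p0 by (intro AE_I2) (smt (verit) real_norm_def)
  qed simp
  let ?y = "\<lambda>n. \<i> * of_real (real (Suc n))"
  have nz: "?y n - of_real t \<noteq> 0" for n t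
    by (rule resolvent_nonzero) simp
  have "(\<lambda>n. LINT t|lborel. ?y n * (complex_of_real (p t) / (?y n - of_real t))) \<longlonglongrightarrow> (LINT t|lborel. complex_of_real (p t))"
  proof (rule integral_dominated_convergence[where w = p])
    show "AE t in lborel. (\<lambda>n. ?y n * (complex_of_real (p t) / (?y n - of_real t))) \<longlonglongrightarrow> complex_of_real (p t)"
    proof (rule AE_I2)
      fix t :: real
      have "(\<lambda>n. complex_of_real t / (?y n - of_real t)) \<longlonglongrightarrow> 0"
      proof (rule Lim_null_comparison)
        show "eventually (\<lambda>n. norm (complex_of_real t / (?y n - of_real t)) \<le> \<bar>t\<bar> / real (Suc n)) sequentially"
        proof (rule always_eventually, rule allI)
          fix n
          have "norm (1 / (?y n - of_real t)) \<le> 1 / Im (?y n)"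
            by (rule norm_resolvent_le) simp
          then have "\<bar>t\<bar> * norm (1 / (?y n - of_real t)) \<le> \<bar>t\<bar> * (1 / real (Suc n))"
            by (intro mult_left_mono) (simp_all del: of_nat_Suc)
          then show "norm (complex_of_real t / (?y n - of_real t)) \<le> \<bar>t\<bar> / real (Suc n)"
            by (simp add: norm_divide del: of_nat_Suc)
        qed
        show "(\<lambda>n. \<bar>t\<bar> / real (Suc n)) \<longlonglongrightarrow> 0"
          by (rule lim_const_over_n[THEN LIMSEQ_Suc])
      qed
      then have "(\<lambda>n. complex_of_real (p t) * (1 + complex_of_real t / (?y n - of_real t))) \<longlonglongrightarrow> complex_of_real (p t) * (1 + 0)"
        by (intro tendsto_intros)
      moreover have "complex_of_real (p t) * (1 + complex_of_real t / (?y n - of_real t))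
          = ?y n * (complex_of_real (p t) / (?y n - of_real t))" for n
        using nz[of n t] by (simp add: divide_simps)
      ultimately show "(\<lambda>n. ?y n * (complex_of_real (p t) / (?y n - of_real t))) \<longlonglongrightarrow> complex_of_real (p t)"
        by simp
    qed
    show "AE t in lborel. norm (?y n * (complex_of_real (p t) / (?y n - of_real t))) \<le> p t" for n
    proof (rule AE_I2)
      fix t :: real
      have "norm (1 / (?y n - of_real t)) \<le> 1 / Im (?y n)"
        by (rule norm_resolvent_le) simp
      then have "real (Suc n) * norm (1 / (?y n - of_real t)) * p t \<le> real (Suc n) * (1 / real (Suc n)) * p t"
        using p0[of t] by (intro mult_right_mono mult_left_mono) (simp_all del: of_nat_Suc)
      then show "norm (?y n * (complex_of_real (p t) / (?y n - of_real t))) \<le> p t"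
        using p0[of t] by (simp add: norm_mult norm_divide del: of_nat_Suc)
    qed
  qed (use intp in auto)
  moreover have "(LINT t|lborel. ?y n * (complex_of_real (p t) / (?y n - of_real t))) = ?y n * G (?y n)" for n
    using rep[of "?y n"] by (simp only: integral_mult_right_zero) simp
  ultimately have lim1: "(\<lambda>n. ?y n * G (?y n)) \<longlonglongrightarrow> complex_of_real (integral\<^sup>L lborel p)"
    by simp
  have "(\<lambda>n. ?y n * G (?y n) - 1) \<longlonglongrightarrow> 0"
  proof (rule Lim_null_comparison)
    show "eventually (\<lambda>n. norm (?y n * G (?y n) - 1) \<le> K * C / real (Suc n)) sequentially"
    proof (rule always_eventually, rule allI)
      fix n
      have im: "Im (?y n) \<ge> 0" by simp
      have F0: "cmod (F (?y n)) > 0"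
        by (rule less_le_trans[OF del(1) Fd[OF im]])
      have "?y n * G (?y n) - 1 = - (F (?y n) - ?y n) * G (?y n)"
        using F0 unfolding G_def by (simp add: divide_simps)
      then have "norm (?y n * G (?y n) - 1) = cmod (F (?y n) - ?y n) * cmod (G (?y n))"
        by (simp only: norm_mult norm_minus_cancel)
      also have "\<dots> \<le> K * (C / real (Suc n))"
      proof (intro mult_mono)
        have "cmod (G (?y n)) * real (Suc n) \<le> cmod (G (?y n)) * (1 + cmod (?y n))"
          by (intro mult_left_mono) (simp_all add: norm_mult del: of_nat_Suc)
        then show "cmod (G (?y n)) \<le> C / real (Suc n)"
          using bound[OF im] by (simp add: pos_le_divide_eq del: of_nat_Suc)
      qed (use K[OF im] K0 in auto)
      finally show "norm (?y n * G (?y n) - 1) \<le> K * C / real (Suc n)"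
        by simp
    qed
    show "(\<lambda>n. K * C / real (Suc n)) \<longlonglongrightarrow> 0"
      by (rule lim_const_over_n[THEN LIMSEQ_Suc])
  qed
  then have "(\<lambda>n. ?y n * G (?y n)) \<longlonglongrightarrow> 1"
    using tendsto_add[OF _ tendsto_const[of 1]] by fastforce
  with lim1 have "complex_of_real (integral\<^sup>L lborel p) = 1"
    using LIMSEQ_unique by blast
  then have mass: "integral\<^sup>L lborel p = 1"
    by simp
  let ?M = "density lborel (\<lambda>t. ennreal (p t))"
  have "emeasure ?M (space ?M) = 1"
    using mass intp p0 by (simp add: emeasure_density nn_integral_eq_integral)
  then have "prob_space ?M"
    by (rule prob_spaceI)
  then show "real_distribution ?M"
    by (simp add: real_distribution_def real_distribution_axioms_def)
  show "F_transform ?M z = F z" if "Im z > 0" for z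
  proof -
    have "cauchy_transform ?M z = (LINT t|lborel. p t *\<^sub>R (1 / (z - complex_of_real t)))"
      unfolding cauchy_transform_def using p0 by (intro integral_density) auto
    also have "\<dots> = G z"
      unfolding rep[OF that] by (simp add: scaleR_conv_of_real)
    finally show ?thesis
      by (simp add: F_transform_def G_def)
  qed
qed

text \<open>
  For \<open>c > 0\<close> this is the previous lemma for \<open>F z = z + i c\<close>, whose predicted density is the Cauchy density.
\<close>

lemma F_transform_cauchy_distribution:
  assumes "c \<ge> 0"
  shows "real_distribution (cauchy_distribution c)"
    and "Im z > 0 \<Longrightarrow> F_transform (cauchy_distribution c) z = z + \<i> * of_real c"
proof -
  have "real_distribution (cauchy_distribution c) \<and> (Im z > 0 \<longrightarrow> F_transform (cauchy_distribution c) z = z + \<i> * of_real c)" for z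
  proof (cases "c = 0")
    case True
    interpret prob_space "return borel (0::real)"
      by (rule prob_space_return) simp
    have "real_distribution (return borel (0::real))"
      by standard auto
    moreover have "cauchy_transform (return borel (0::real)) z = 1 / z" if "Im z > 0"
      unfolding cauchy_transform_def by (subst integral_return) auto
    ultimately show ?thesis
      using True by (simp add: cauchy_distribution_def F_transform_def)
  next
    case False
    let ?F = "\<lambda>z. z + \<i> * complex_of_real c"
    have c: "c > 0" using assms False by simp
    have p: "- Im (1 / ?F (complex_of_real t)) / pi = 1 / pi * (c / (t\<^sup>2 + c\<^sup>2))" for t
      using c by (simp add: Im_divide)
    have "real_distribution (density lborel (\<lambda>t. ennreal (- Im (1 / ?F (complex_of_real t)) / pi)))"
      by (rule measure_of_shifted_F_transform(1)[of c ?F c c]) (use c in \<open>auto intro!: holomorphic_intros simp: norm_mult\<close>)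
    moreover have "F_transform (density lborel (\<lambda>t. ennreal (- Im (1 / ?F (complex_of_real t)) / pi))) z = ?F z" if "Im z > 0"
      by (rule measure_of_shifted_F_transform(2)[of c ?F c c]) (use c that in \<open>auto intro!: holomorphic_intros simp: norm_mult\<close>)
    ultimately show ?thesis
      using False unfolding p cauchy_distribution_def by simp
  qed
  then show "real_distribution (cauchy_distribution c)"
    and "Im z > 0 \<Longrightarrow> F_transform (cauchy_distribution c) z = z + \<i> * of_real c"
    by blast+
qed

text \<open>
  A version of Nevanlinna's theorem.  The functions \<open>F (z + i e)\<close> extend across the real line and hence are
  \<open>F\<close>-transforms of explicit measures.  These are tight as \<open>e \<rightarrow> 0\<close>: the mass outside \<open>{-y<..<y}\<close> is at most
  \<open>2 E (t\<^sup>2 / (t\<^sup>2 + y\<^sup>2)) = 2 Re (1 - i y G (i y))\<close>, which is \<open>O(1 / y)\<close> uniformly in \<open>e\<close>.  By Helly selection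
  some subsequence converges weakly, and its Cauchy transforms converge pointwise because the
  resolvent is bounded and continuous on the line.
\<close>

theorem F_transform_exists:
  fixes F :: "complex \<Rightarrow> complex"
  assumes F: "F holomorphic_on half_plane 0"
    and Im_ge: "\<And>z. Im z > 0 \<Longrightarrow> Im (F z) \<ge> Im z"
    and K: "\<And>e. e > 0 \<Longrightarrow> \<exists>K. \<forall>z. Im z \<ge> e \<longrightarrow> cmod (F z - z) \<le> K"
  shows "\<exists>\<mu>. real_distribution \<mu> \<and> (\<forall>z\<in>half_plane 0. F_transform \<mu> z = F z)"
proof -
  define e where "e n = 1 / real (Suc n)" for n
  have e0: "e n > 0" and e1: "e n \<le> 1" for n
    by (simp_all add: e_def)
  define Fn where "Fn n z = F (z + \<i> * of_real (e n))" for n z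
  have "\<exists>\<mu>. real_distribution \<mu> \<and> (\<forall>z. Im z > 0 \<longrightarrow> F_transform \<mu> z = Fn n z)" for n
  proof -
    obtain K where K: "\<And>z. Im z \<ge> e n \<Longrightarrow> cmod (F z - z) \<le> K"
      using K[OF e0] by blast
    have hol: "Fn n holomorphic_on half_plane (- (e n / 2))"
      unfolding Fn_def using e0[of n]
      by (intro holomorphic_on_compose[OF _ holomorphic_on_subset[OF F], unfolded o_def] holomorphic_intros) auto
    have pos: "Im (Fn n z) > 0" if "Im z > - (e n / 2)" for z
      using Im_ge[of "z + \<i> * of_real (e n)"] that e0[of n] by (simp add: Fn_def)
    have del: "Im (Fn n z) \<ge> e n" if "Im z \<ge> 0" for z
      using Im_ge[of "z + \<i> * of_real (e n)"] that e0[of n] by (simp add: Fn_def)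
    have bd: "cmod (Fn n z - z) \<le> K + e n" if "Im z \<ge> 0" for z
    proof -
      have "Fn n z - z = (F (z + \<i> * of_real (e n)) - (z + \<i> * of_real (e n))) + \<i> * of_real (e n)"
        by (simp add: Fn_def)
      moreover have "cmod (F (z + \<i> * of_real (e n)) - (z + \<i> * of_real (e n))) \<le> K"
        using that by (intro K) simp
      moreover have "cmod (\<i> * of_real (e n)) = e n"
        using e0[of n] by (simp add: norm_mult)
      ultimately show ?thesis
        using norm_triangle_ineq[of "F (z + \<i> * of_real (e n)) - (z + \<i> * of_real (e n))" "\<i> * of_real (e n)"]
        by (simp only:)
    qed
    have "e n / 2 > 0" using e0[of n] by simp
    note m = measure_of_shifted_F_transform[OF this hol pos e0 del bd]
    show ?thesis
      using m by blast
  qed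
  then obtain \<mu> where \<mu>: "\<And>n. real_distribution (\<mu> n)" "\<And>n z. Im z > 0 \<Longrightarrow> F_transform (\<mu> n) z = Fn n z"
    by metis
  obtain K1 where K1: "\<And>z. Im z \<ge> 1 \<Longrightarrow> cmod (F z - z) \<le> K1"
    using K[of 1] by auto
  have K10: "K1 \<ge> 0"
    using K1[of \<i>] by (smt (verit) norm_ge_zero imaginary_unit.simps)
  have tail: "measure (\<mu> n) {t. \<bar>t\<bar> \<ge> y} \<le> 2 * (K1 + 1) / y" if y: "y \<ge> 1" for n y
  proof -
    interpret real_distribution "\<mu> n" by (rule \<mu>)
    let ?z = "\<i> * complex_of_real y" and ?G = "cauchy_transform (\<mu> n)"
    have z: "Im ?z > 0" using y by simp
    have int: "integrable (\<mu> n) (\<lambda>t. (cmod (1 / (?z - complex_of_real t)))\<^sup>2)"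
      by (rule integrable_resolvent_power2[OF z])
    have Fy: "F_transform (\<mu> n) ?z = F (?z + \<i> * of_real (e n))"
      using \<mu>(2)[OF z] by (simp add: Fn_def)
    have Fd: "cmod (F_transform (\<mu> n) ?z - ?z) \<le> K1 + 1"
    proof -
      have "cmod (F (?z + \<i> * of_real (e n)) - (?z + \<i> * of_real (e n))) \<le> K1"
        using y e0[of n] by (intro K1) auto
      moreover have "cmod (\<i> * of_real (e n)) \<le> 1"
        using e0[of n] e1[of n] by (simp add: norm_mult)
      moreover have "F_transform (\<mu> n) ?z - ?z = (F (?z + \<i> * of_real (e n)) - (?z + \<i> * of_real (e n))) + \<i> * of_real (e n)"
        by (simp add: Fy)
      ultimately show ?thesis
        using norm_triangle_ineq[of "F (?z + \<i> * of_real (e n)) - (?z + \<i> * of_real (e n))" "\<i> * of_real (e n)"]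
        by (simp only:)
    qed
    have Fge: "cmod (F_transform (\<mu> n) ?z) \<ge> y"
      using Im_F_transform_ge[OF z] abs_Im_le_cmod[of "F_transform (\<mu> n) ?z"] y by simp
    have G0: "?G ?z \<noteq> 0" by (rule cauchy_transform_nonzero[OF z])
    have "1 - ?z * ?G ?z = (F_transform (\<mu> n) ?z - ?z) / F_transform (\<mu> n) ?z"
      using G0 by (simp add: F_transform_def field_simps)
    then have "cmod (1 - ?z * ?G ?z) \<le> (K1 + 1) / y"
      using Fd Fge y K10 by (simp add: norm_divide frac_le)
    moreover have "Re (1 - ?z * ?G ?z) = 1 + y * Im (?G ?z)"
      by simp
    ultimately have *: "1 + y * Im (?G ?z) \<le> (K1 + 1) / y"
      using complex_Re_le_cmod[of "1 - ?z * ?G ?z"] by linarith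
    have "measure (\<mu> n) {t. \<bar>t\<bar> \<ge> y} / 2 = expectation (\<lambda>t. indicat_real {t. \<bar>t\<bar> \<ge> y} t / 2)"
      by simp
    also have "\<dots> \<le> expectation (\<lambda>t. 1 - y\<^sup>2 * (cmod (1 / (?z - complex_of_real t)))\<^sup>2)"
    proof (rule integral_mono)
      show "integrable (\<mu> n) (\<lambda>t. indicat_real {t. \<bar>t\<bar> \<ge> y} t / 2)"
        by (rule integrable_const_bound[of _ 1]) (auto simp: indicator_def)
      show "integrable (\<mu> n) (\<lambda>t. 1 - y\<^sup>2 * (cmod (1 / (?z - complex_of_real t)))\<^sup>2)"
        using int by (intro Bochner_Integration.integrable_diff integrable_mult_right) auto
      show "indicat_real {t. \<bar>t\<bar> \<ge> y} t / 2 \<le> 1 - y\<^sup>2 * (cmod (1 / (?z - complex_of_real t)))\<^sup>2" for t :: real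
      proof -
        define q where "q = y\<^sup>2 / (t\<^sup>2 + y\<^sup>2)"
        have q: "y\<^sup>2 * (cmod (1 / (?z - complex_of_real t)))\<^sup>2 = q"
          by (simp add: q_def norm_divide power_divide cmod_power2)
        have "q \<le> 1"
          using y by (simp add: q_def divide_simps add_nonneg_pos)
        moreover have "q \<le> 1 / 2" if "\<bar>t\<bar> \<ge> y"
        proof -
          have "y\<^sup>2 \<le> t\<^sup>2"
            using that y abs_le_square_iff[of y t] by simp
          then have "y\<^sup>2 / (t\<^sup>2 + y\<^sup>2) \<le> y\<^sup>2 / (y\<^sup>2 + y\<^sup>2)"
            using y by (intro divide_left_mono) (auto intro!: mult_pos_pos add_nonneg_pos)
          then show ?thesis
            using y by (simp add: q_def)
        qed
        ultimately show ?thesis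
          unfolding q by (auto simp: indicator_def)
      qed
    qed
    also have "\<dots> = 1 - y\<^sup>2 * expectation (\<lambda>t. (cmod (1 / (?z - complex_of_real t)))\<^sup>2)"
      using int prob_space by (simp del: norm_divide)
    also have "\<dots> = 1 + y * Im (?G ?z)"
      unfolding Im_cauchy_transform[OF z] by (simp add: power2_eq_square)
    finally have "measure (\<mu> n) {t. \<bar>t\<bar> \<ge> y} / 2 \<le> (K1 + 1) / y"
      using * by linarith
    then show ?thesis
      by (simp add: mult.commute)
  qed
  have tight: "tight \<mu>"
    unfolding tight_def
  proof (intro conjI allI impI)
    fix \<epsilon> :: real assume eps: "\<epsilon> > 0"
    define y where "y = max 1 (4 * (K1 + 1) / \<epsilon>)"
    have y: "y \<ge> 1" "y \<ge> 4 * (K1 + 1) / \<epsilon>"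
      by (simp_all add: y_def)
    have "measure (\<mu> n) {-y<..y} > 1 - \<epsilon>" for n
    proof -
      interpret real_distribution "\<mu> n" by (rule \<mu>)
      have "2 * (K1 + 1) / y \<le> \<epsilon> / 2"
        using y eps K10 by (simp add: field_simps)
      then have "prob {t. \<bar>t\<bar> \<ge> y} < \<epsilon>"
        using tail[OF y(1), of n] eps by linarith
      moreover have "1 - prob {-y<..y} \<le> prob {t. \<bar>t\<bar> \<ge> y}"
      proof -
        have "1 - prob {-y<..y} = prob (UNIV - {-y<..y})"
          using prob_compl[of "{-y<..y}"] by simp
        also have "\<dots> \<le> prob {t. \<bar>t\<bar> \<ge> y}"
          by (intro finite_measure_mono) auto
        finally show ?thesis .
      qed
      ultimately show ?thesis by linarith
    qed
    then show "\<exists>a b. a < b \<and> (\<forall>n. 1 - \<epsilon> < measure (\<mu> n) {a<..b})"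
      using y by (intro exI[of _ "-y"] exI[of _ y]) auto
  qed (rule \<mu>)
  obtain r M where r: "strict_mono r" and M: "real_distribution M" and weak: "weak_conv_m (\<mu> \<circ> id \<circ> r) M"
    using tight_imp_convergent_subsubsequence[OF tight, of id] by (auto simp: strict_mono_def)
  have "F_transform M z = F z" if z: "Im z > 0" for z
  proof -
    interpret M: real_distribution M by (rule M)
    have F0: "F z \<noteq> 0"
      using Im_ge[OF z] z by auto
    have lim1: "(\<lambda>n. cauchy_transform (\<mu> (r n)) z) \<longlonglongrightarrow> cauchy_transform M z"
    proof -
      have "(\<lambda>n. integral\<^sup>L ((\<mu> \<circ> id \<circ> r) n) (\<lambda>t. 1 / (z - complex_of_real t))) \<longlonglongrightarrow> integral\<^sup>L M (\<lambda>t. 1 / (z - complex_of_real t))"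
      proof (rule weak_conv_imp_integral_bdd_continuous_conv)
        show "isCont (\<lambda>t. 1 / (z - complex_of_real t)) x" for x
          using resolvent_nonzero[OF z] by (intro continuous_intros) auto
        show "norm (1 / (z - complex_of_real x)) \<le> 1 / Im z" for x
          by (rule norm_resolvent_le[OF z])
      qed (use \<mu> M weak in \<open>auto simp: o_def\<close>)
      then show ?thesis
        by (simp add: cauchy_transform_def)
    qed
    have "isCont F z"
      using F z holomorphic_on_imp_continuous_on[OF F] continuous_on_eq_continuous_at[OF open_half_plane]
      by (metis half_plane_iff)
    moreover have "(\<lambda>n. z + \<i> * of_real (e (r n))) \<longlonglongrightarrow> z + \<i> * of_real 0"
    proof (intro tendsto_intros)
      have "e \<longlonglongrightarrow> 0"
        unfolding e_def by (rule lim_1_over_n[THEN LIMSEQ_Suc])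
      then show "(\<lambda>n. e (r n)) \<longlonglongrightarrow> 0"
        using LIMSEQ_subseq_LIMSEQ[OF _ r] by (auto simp: o_def)
    qed
    ultimately have "(\<lambda>n. Fn (r n) z) \<longlonglongrightarrow> F z"
      unfolding Fn_def by (intro isCont_tendsto_compose[of z F]) auto
    then have "(\<lambda>n. 1 / Fn (r n) z) \<longlonglongrightarrow> 1 / F z"
      using F0 by (intro tendsto_intros)
    moreover have "1 / Fn (r n) z = cauchy_transform (\<mu> (r n)) z" for n
      using \<mu>(2)[OF z, of "r n"] by (simp add: F_transform_def flip: \<mu>(2)[OF z])
    ultimately have "cauchy_transform M z = 1 / F z"
      using LIMSEQ_unique[OF lim1] by simp
    then show ?thesis
      by (simp add: F_transform_def)
  qed
  then show ?thesis
    using M by auto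
qed

section \<open>A measure is determined by its F-transform\<close>

context real_distribution
begin

text \<open>
  The function \<open>x \<mapsto> - Im (G (x + i c)) / \<pi>\<close> is the density of the classical convolution of \<open>M\<close> with the Cauchy
  distribution, so its Fourier transform is a product; the interchange of integrals is Fubini.
\<close>

lemma char_times_char_cauchy:
  assumes c: "c > 0"
  shows "char M s * char (cauchy_distribution c) s
    = (LINT x|lborel. iexp (s * x) * of_real (- Im (cauchy_transform M (Complex x c)) / pi))"
proof -
  define k where "k u = 1 / pi * (c / (u\<^sup>2 + c\<^sup>2))" for u :: real
  have k0: "k u \<ge> 0" for u
    unfolding k_def using c by simp
  have km [measurable]: "k \<in> borel_measurable borel"
    unfolding k_def[abs_def] by measurable
  interpret C: real_distribution "cauchy_distribution c"
    using F_transform_cauchy_distribution(1) c by simp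
  have Cd: "cauchy_distribution c = density lborel (\<lambda>u. ennreal (k u))"
    using c by (simp add: cauchy_distribution_def k_def)
  have mass: "(\<integral>\<^sup>+ u. ennreal (k u) \<partial>lborel) = 1"
    using C.emeasure_space_1 unfolding Cd by (simp add: emeasure_density)
  then have intk: "integrable lborel k"
    using k0 by (intro integrableI_nonneg) auto
  have charC: "char (cauchy_distribution c) s = (LINT u|lborel. iexp (s * u) * of_real (k u))"
    unfolding char_def Cd using k0
    by (subst integral_density) (auto simp: scaleR_conv_of_real mult.commute)
  interpret P: pair_sigma_finite M lborel ..
  let ?f = "\<lambda>(t, x). iexp (s * x) * complex_of_real (k (x - t))"
  have fm: "?f \<in> borel_measurable (M \<Otimes>\<^sub>M lborel)"
    by measurable
  have shift: "(LINT x|lborel. iexp (s * x) * of_real (k (x - t))) = iexp (s * t) * char (cauchy_distribution c) s" for t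
  proof -
    have "(LINT x|lborel. iexp (s * x) * of_real (k (x - t))) = (LINT u|lborel. iexp (s * (t + u)) * of_real (k u))"
      by (subst lborel_integral_real_affine[where c = 1 and t = t]) auto
    also have "\<dots> = (LINT u|lborel. iexp (s * t) * (iexp (s * u) * of_real (k u)))"
      by (intro Bochner_Integration.integral_cong refl) (simp add: distrib_left exp_add)
    finally show ?thesis
      unfolding charC by simp
  qed
  have intshift: "integrable lborel (\<lambda>x. k (x - t))" for t
    using lborel_integrable_real_affine[OF intk, of 1 "- t"] by simp
  have intf: "integrable lborel (\<lambda>x. iexp (s * x) * complex_of_real (k (x - t)))" for t
    by (rule Bochner_Integration.integrable_bound[OF intshift[of t]]) (auto simp: norm_mult)
  have "integrable (M \<Otimes>\<^sub>M lborel) ?f"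
  proof (rule P.Fubini_integrable[OF fm])
    have "(LINT x|lborel. norm (?f (t, x))) = 1" for t
    proof -
      have "(LINT x|lborel. norm (?f (t, x))) = (LINT x|lborel. k (x - t))"
        using k0 by (intro Bochner_Integration.integral_cong) (auto simp: norm_mult)
      also have "\<dots> = (LINT u|lborel. k u)"
        by (subst lborel_integral_real_affine[where c = 1 and t = t]) auto
      also have "\<dots> = 1"
        using mass k0 by (simp add: integral_eq_nn_integral)
      finally show ?thesis .
    qed
    then show "integrable M (\<lambda>t. LINT x|lborel. norm (?f (t, x)))"
      by simp
    show "AE t in M. integrable lborel (\<lambda>x. ?f (t, x))"
      using intf by simp
  qed
  note fub = P.Fubini_integral[OF this]
  have "char M s * char (cauchy_distribution c) s = (LINT t|M. iexp (s * t) * char (cauchy_distribution c) s)"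
    unfolding char_def by simp
  also have "\<dots> = (LINT t|M. LINT x|lborel. ?f (t, x))"
    by (simp only: shift prod.case)
  also have "\<dots> = (LINT x|lborel. LINT t|M. ?f (t, x))"
    using fub by simp
  also have "\<dots> = (LINT x|lborel. iexp (s * x) * of_real (- Im (cauchy_transform M (Complex x c)) / pi))"
  proof (intro Bochner_Integration.integral_cong refl)
    fix x :: real
    have z: "Im (Complex x c) > 0" using c by simp
    have "(LINT t|M. ?f (t, x)) = iexp (s * x) * of_real (LINT t|M. k (x - t))"
      by simp
    also have "(LINT t|M. k (x - t)) = (LINT t|M. 1 / pi * (c * (cmod (1 / (Complex x c - complex_of_real t)))\<^sup>2))"
      by (intro Bochner_Integration.integral_cong refl)
         (simp add: k_def norm_divide power_divide cmod_power2)
    also have "\<dots> = - Im (cauchy_transform M (Complex x c)) / pi"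
      unfolding Im_cauchy_transform[OF z] by simp
    finally show "(LINT t|M. ?f (t, x)) = iexp (s * x) * of_real (- Im (cauchy_transform M (Complex x c)) / pi)" .
  qed
  finally show ?thesis .
qed

end

lemma char_cauchy_distribution_scale:
  assumes "c > 0"
  shows "char (cauchy_distribution c) s = char (cauchy_distribution 1) (c * s)"
proof -
  have "char (cauchy_distribution b) r = (LINT u|lborel. iexp (r * u) * of_real (1 / pi * (b / (u\<^sup>2 + b\<^sup>2))))" if "b > 0" for b r
    unfolding char_def cauchy_distribution_def using that
    by (simp, subst integral_density) (auto simp: scaleR_conv_of_real mult.commute)
  note ch = this
  have "char (cauchy_distribution c) s = (LINT u|lborel. iexp (s * u) * of_real (1 / pi * (c / (u\<^sup>2 + c\<^sup>2))))"
    by (rule ch[OF assms])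
  also have "\<dots> = \<bar>c\<bar> *\<^sub>R (LINT u|lborel. iexp (s * (0 + c * u)) * of_real (1 / pi * (c / ((0 + c * u)\<^sup>2 + c\<^sup>2))))"
    by (rule lborel_integral_real_affine) (use assms in auto)
  also have "\<dots> = (LINT u|lborel. of_real c * (iexp (s * (0 + c * u)) * of_real (1 / pi * (c / ((0 + c * u)\<^sup>2 + c\<^sup>2)))))"
    using assms by (simp only: integral_mult_right_zero scaleR_conv_of_real abs_of_pos)
  also have "\<dots> = (LINT u|lborel. iexp (c * s * u) * of_real (1 / pi * (1 / (u\<^sup>2 + 1\<^sup>2))))"
  proof (intro Bochner_Integration.integral_cong refl)
    fix u :: real
    have "c * (1 / pi * (c / ((0 + c * u)\<^sup>2 + c\<^sup>2))) = 1 / pi * (c\<^sup>2 / (c\<^sup>2 * (u\<^sup>2 + 1\<^sup>2)))"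
      by (simp add: power_mult_distrib power2_eq_square distrib_left)
    also have "\<dots> = 1 / pi * (1 / (u\<^sup>2 + 1\<^sup>2))"
      using assms by simp
    finally have "complex_of_real (c * (1 / pi * (c / ((0 + c * u)\<^sup>2 + c\<^sup>2)))) = of_real (1 / pi * (1 / (u\<^sup>2 + 1\<^sup>2)))"
      by simp
    moreover have "of_real c * (iexp (s * (0 + c * u)) * of_real (1 / pi * (c / ((0 + c * u)\<^sup>2 + c\<^sup>2))))
        = iexp (c * s * u) * complex_of_real (c * (1 / pi * (c / ((0 + c * u)\<^sup>2 + c\<^sup>2))))"
      by (simp add: ac_simps)
    ultimately show "of_real c * (iexp (s * (0 + c * u)) * of_real (1 / pi * (c / ((0 + c * u)\<^sup>2 + c\<^sup>2))))
      = iexp (c * s * u) * of_real (1 / pi * (1 / (u\<^sup>2 + 1\<^sup>2)))"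
      by (simp only:)
  qed
  also have "\<dots> = char (cauchy_distribution 1) (c * s)"
    by (rule ch[symmetric]) simp
  finally show ?thesis .
qed

text \<open>
  The previous lemmas recover from the Cauchy transform the product of the characteristic function with that of
  a Cauchy distribution of any parameter \<open>c\<close>.  For small \<open>c\<close> the second factor is close to \<open>1\<close>, hence
  can be cancelled, and Levy's uniqueness theorem applies.
\<close>

theorem F_transform_unique:
  assumes \<mu>: "real_distribution \<mu>" and \<nu>: "real_distribution \<nu>"
    and eq: "\<And>z. Im z > 0 \<Longrightarrow> F_transform \<mu> z = F_transform \<nu> z"
  shows "\<mu> = \<nu>"
proof (rule Levy_uniqueness[OF \<mu> \<nu>], rule ext)
  fix s :: real
  have G: "cauchy_transform \<mu> z = cauchy_transform \<nu> z" if "Im z > 0" for z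
    using eq[OF that] by (simp add: F_transform_def)
  interpret C: real_distribution "cauchy_distribution 1"
    by (rule F_transform_cauchy_distribution) simp
  have "((\<lambda>c. char (cauchy_distribution 1) (c * s)) \<longlongrightarrow> char (cauchy_distribution 1) 0) (at_right 0)"
    by (rule isCont_tendsto_compose[OF C.isCont_char]) (auto intro!: tendsto_eq_intros)
  then have "eventually (\<lambda>c. char (cauchy_distribution 1) (c * s) \<noteq> 0) (at_right 0)"
    by (rule tendsto_imp_eventually_ne) (simp add: C.char_zero)
  then have "eventually (\<lambda>c. c > 0 \<and> char (cauchy_distribution 1) (c * s) \<noteq> 0) (at_right (0::real))"
    using eventually_at_right_less[of "0::real"] by eventually_elim simp
  then obtain c where c: "c > 0" "char (cauchy_distribution 1) (c * s) \<noteq> 0"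
    using eventually_happens' trivial_limit_at_right_real by blast
  have "char \<mu> s * char (cauchy_distribution c) s = char \<nu> s * char (cauchy_distribution c) s"
    unfolding real_distribution.char_times_char_cauchy[OF \<mu> c(1)] real_distribution.char_times_char_cauchy[OF \<nu> c(1)]
    using c(1) by (simp add: G)
  then show "char \<mu> s = char \<nu> s"
    using c(2) char_cauchy_distribution_scale[OF c(1), of s] by simp
qed

section \<open>Inverses on truncated cones and uniqueness of free convolutions\<close>

lemma truncated_cone_iff: "z \<in> truncated_cone \<alpha> \<beta> \<longleftrightarrow> Im z > \<beta> \<and> \<bar>Re z\<bar> < \<alpha> * Im z"
  by (simp add: truncated_cone_def)

lemma truncated_cone_mono: "\<beta> \<le> \<beta>' \<Longrightarrow> truncated_cone \<alpha> \<beta>' \<subseteq> truncated_cone \<alpha> \<beta>"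
  by (auto simp: truncated_cone_def)

lemma convex_truncated_cone: "convex (truncated_cone \<alpha> \<beta>)"
proof (rule convexI)
  fix x y :: complex and u v :: real
  assume x: "x \<in> truncated_cone \<alpha> \<beta>" and y: "y \<in> truncated_cone \<alpha> \<beta>" and uv: "u \<ge> 0" "v \<ge> 0" "u + v = 1"
  have "u * (- Im x) + v * (- Im y) < - \<beta>"
    using x y uv by (intro convex_bound_lt) (auto simp: truncated_cone_iff)
  moreover have "u * (Re x - \<alpha> * Im x) + v * (Re y - \<alpha> * Im y) < 0"
    using x y uv by (intro convex_bound_lt) (auto simp: truncated_cone_iff)
  moreover have "u * (- Re x - \<alpha> * Im x) + v * (- Re y - \<alpha> * Im y) < 0"
    using x y uv by (intro convex_bound_lt) (auto simp: truncated_cone_iff)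
  ultimately show "u *\<^sub>R x + v *\<^sub>R y \<in> truncated_cone \<alpha> \<beta>"
    by (simp add: truncated_cone_iff abs_less_iff algebra_simps)
qed

lemma cmod_le_cone:
  assumes "z \<in> truncated_cone \<alpha> \<beta>" "\<beta> > 0"
  shows "cmod z \<le> (\<alpha> + 1) * Im z"
  using cmod_le[of z] assms by (simp add: truncated_cone_iff algebra_simps)

text \<open>
  Room for the Cauchy estimate and for the fixed point argument: discs of radius \<open>Im z / 2\<close> around the points of a
  cone stay in a wider cone.
\<close>

lemma cball_subset_truncated_cone:
  assumes z: "z \<in> truncated_cone \<alpha> (2 * \<beta>)" and "\<alpha> > 0" "\<beta> > 0"
  shows "cball z (Im z / 2) \<subseteq> truncated_cone (2 * \<alpha> + 1) \<beta>"
proof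
  fix w assume "w \<in> cball z (Im z / 2)"
  then have d: "cmod (w - z) \<le> Im z / 2"
    by (simp add: dist_norm norm_minus_commute)
  have zz: "Im z > 2 * \<beta>" "\<bar>Re z\<bar> < \<alpha> * Im z"
    using z by (auto simp: truncated_cone_iff)
  have im: "Im w \<ge> Im z / 2"
    using abs_Im_le_cmod[of "w - z"] d by simp
  have "\<bar>Re w\<bar> \<le> \<bar>Re z\<bar> + Im z / 2"
    using abs_Re_le_cmod[of "w - z"] d by simp
  also have "\<dots> < (2 * \<alpha> + 1) * (Im z / 2)"
    using zz by (simp add: algebra_simps)
  also have "\<dots> \<le> (2 * \<alpha> + 1) * Im w"
    using im assms by (intro mult_left_mono) auto
  finally show "w \<in> truncated_cone (2 * \<alpha> + 1) \<beta>"
    using im zz assms by (simp add: truncated_cone_iff)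
qed

text \<open>
  Bounded perturbations do not leave a slightly wider cone, high enough up.  This absorbs all the bounded
  error terms below.
\<close>

lemma shift_into_truncated_cone:
  assumes z: "z \<in> truncated_cone 3 \<beta>" and d: "cmod (w - z) \<le> K" and "\<beta> \<ge> 5 * K"
  shows "w \<in> truncated_cone 4 (\<beta> - K)"
proof -
  have "Im w \<ge> Im z - K" "\<bar>Re w\<bar> \<le> \<bar>Re z\<bar> + K"
    using abs_Im_le_cmod[of "w - z"] abs_Re_le_cmod[of "w - z"] d by auto
  then show ?thesis
    using assms by (auto simp: truncated_cone_iff)
qed

lemma imaginary_axis_in_cone: "\<alpha> > 0 \<Longrightarrow> \<beta> > 0 \<Longrightarrow> y > \<beta> \<Longrightarrow> \<i> * complex_of_real y \<in> truncated_cone \<alpha> \<beta>"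
  by (simp add: truncated_cone_iff)

context real_distribution
begin

text \<open>
  \<open>F z - z\<close> is \<open>o(\<bar>z\<bar>)\<close> in cones, so by Cauchy's estimate on discs of radius proportional to \<open>\<bar>z\<bar>\<close> its derivative
  tends to \<open>0\<close>; a cone is convex.
\<close>

lemma F_transform_minus_id_lipschitz:
  assumes \<alpha>: "\<alpha> > 0"
  shows "\<exists>\<beta>>0. \<forall>z\<in>truncated_cone \<alpha> \<beta>. \<forall>w\<in>truncated_cone \<alpha> \<beta>.
    cmod ((F_transform M z - z) - (F_transform M w - w)) \<le> 1 / 2 * cmod (z - w)"
proof -
  let ?u = "\<lambda>z. F_transform M z - z"
  \<comment> \<open>On the disc \<open>\<bar>x\<bar> \<le> (\<alpha> + 3 / 2) Im z\<close>, so the derivative is at most \<open>\<epsilon> (\<alpha> + 3 / 2) Im z / (Im z / 2) = 1 / 2\<close>.\<close>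
  define \<epsilon> where "\<epsilon> = 1 / (2 * (2 * \<alpha> + 3))"
  have eps: "\<epsilon> > 0" using \<alpha> by (simp add: \<epsilon>_def)
  obtain \<beta> where \<beta>: "\<beta> > 0" "\<And>z. z \<in> truncated_cone (2 * \<alpha> + 1) \<beta> \<Longrightarrow> cmod (?u z) \<le> \<epsilon> * cmod z"
    using F_transform_asymptotic[of "2 * \<alpha> + 1" \<epsilon>] \<alpha> eps by auto
  have hol: "?u holomorphic_on half_plane 0"
    by (intro holomorphic_intros F_transform_holomorphic)
  have pos: "Im z > 0" if "z \<in> truncated_cone \<alpha> (2 * \<beta>)" for z
    using that \<beta>(1) by (simp add: truncated_cone_iff)
  have D: "(?u has_field_derivative deriv ?u z) (at z)" if "z \<in> truncated_cone \<alpha> (2 * \<beta>)" for z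
    using holomorphic_derivI[OF hol open_half_plane] pos[OF that] by simp
  have bd: "norm (deriv ?u z) \<le> 1 / 2" if z: "z \<in> truncated_cone \<alpha> (2 * \<beta>)" for z
  proof -
    have sub: "cball z (Im z / 2) \<subseteq> truncated_cone (2 * \<alpha> + 1) \<beta>"
      using cball_subset_truncated_cone[OF z \<alpha> \<beta>(1)] .
    then have sub0: "cball z (Im z / 2) \<subseteq> half_plane 0"
      using \<beta>(1) by (force simp: truncated_cone_iff)
    have "norm ((deriv ^^ 1) ?u z) \<le> fact 1 * (\<epsilon> * ((\<alpha> + 3 / 2) * Im z)) / (Im z / 2) ^ 1"
    proof (rule Cauchy_inequality)
      show "?u holomorphic_on ball z (Im z / 2)"
        using hol by (rule holomorphic_on_subset) (use sub0 in auto)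
      show "continuous_on (cball z (Im z / 2)) ?u"
        using holomorphic_on_imp_continuous_on[OF hol] by (rule continuous_on_subset) (use sub0 in auto)
      show "norm (?u x) \<le> \<epsilon> * ((\<alpha> + 3 / 2) * Im z)" if "norm (z - x) = Im z / 2" for x
      proof -
        have "norm (?u x) \<le> \<epsilon> * cmod x"
          using that sub by (intro \<beta>(2)) (auto simp: dist_norm)
        also have "cmod x \<le> cmod z + Im z / 2"
          using norm_triangle_ineq4[of z "z - x"] that by simp
        also have "cmod z \<le> (\<alpha> + 1) * Im z"
          using cmod_le_cone[OF z] \<beta>(1) by simp
        finally show ?thesis
          using eps by (simp add: algebra_simps)
      qed
    qed (use pos[OF z] in auto)
    also have "\<dots> = 1 / 2"
    proof -
      have "(\<alpha> + 3 / 2) * Im z = (2 * \<alpha> + 3) * (Im z / 2)"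
        by (simp add: algebra_simps)
      then show ?thesis
        using pos[OF z] \<alpha> unfolding \<epsilon>_def by simp
    qed
    finally show ?thesis by simp
  qed
  show ?thesis
  proof (intro exI conjI ballI)
    show "2 * \<beta> > 0" using \<beta>(1) by simp
    fix z w assume "z \<in> truncated_cone \<alpha> (2 * \<beta>)" "w \<in> truncated_cone \<alpha> (2 * \<beta>)"
    then show "cmod (?u z - ?u w) \<le> 1 / 2 * cmod (z - w)"
      using field_differentiable_bound[OF convex_truncated_cone has_field_derivative_at_within[OF D] bd] by blast
  qed
qed

lemma F_transform_inj_on_cone:
  assumes "\<alpha> > 0"
  shows "\<exists>\<beta>>0. inj_on (F_transform M) (truncated_cone \<alpha> \<beta>)"
proof -
  obtain \<beta> where "\<beta> > 0" and \<beta>: "\<And>z w. z \<in> truncated_cone \<alpha> \<beta> \<Longrightarrow> w \<in> truncated_cone \<alpha> \<beta> \<Longrightarrow>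
    cmod ((F_transform M z - z) - (F_transform M w - w)) \<le> 1 / 2 * cmod (z - w)"
    using F_transform_minus_id_lipschitz[OF assms] by blast
  have "z = w" if "z \<in> truncated_cone \<alpha> \<beta>" "w \<in> truncated_cone \<alpha> \<beta>" "F_transform M z = F_transform M w" for z w
    using \<beta>[OF that(1,2)] that(3) by (simp add: norm_minus_commute)
  then show ?thesis
    using \<open>\<beta> > 0\<close> by (auto simp: inj_on_def)
qed

text \<open>
  \<open>F w = z\<close> is the fixed point equation \<open>w = z - (F w - w)\<close>, and the right-hand side contracts the disc of radius
  \<open>Im z / 2\<close> around \<open>z\<close>.
\<close>

lemma F_transform_right_inverse:
  assumes "b > 0"
  shows "\<exists>B>0. \<exists>g. \<forall>z\<in>truncated_cone 1 B. g z \<in> truncated_cone 3 b \<and> F_transform M (g z) = z"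
proof -
  let ?u = "\<lambda>z. F_transform M z - z"
  obtain \<beta>1 where \<beta>1: "\<beta>1 > 0" "\<And>z w. z \<in> truncated_cone 3 \<beta>1 \<Longrightarrow> w \<in> truncated_cone 3 \<beta>1 \<Longrightarrow>
    cmod (?u z - ?u w) \<le> 1 / 2 * cmod (z - w)"
    using F_transform_minus_id_lipschitz[of 3] zero_less_numeral by blast
  \<comment> \<open>Points of the disc have modulus at most \<open>5/2 Im z\<close>, so the factor \<open>1/5\<close> yields the radius \<open>Im z / 2\<close>.\<close>
  obtain \<beta>2 where \<beta>2: "\<beta>2 > 0" "\<And>z. z \<in> truncated_cone 3 \<beta>2 \<Longrightarrow> cmod (?u z) \<le> 1 / 5 * cmod z"
  proof -
    have "(0::real) < 1 / 5" by simp
    then show thesis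
      using F_transform_asymptotic[of 3 "1 / 5"] that zero_less_numeral by blast
  qed
  define \<beta> where "\<beta> = max b (max \<beta>1 \<beta>2)"
  have \<beta>: "\<beta> > 0" "truncated_cone 3 \<beta> \<subseteq> truncated_cone 3 b"
    "truncated_cone 3 \<beta> \<subseteq> truncated_cone 3 \<beta>1" "truncated_cone 3 \<beta> \<subseteq> truncated_cone 3 \<beta>2"
    using assms by (simp_all add: \<beta>_def truncated_cone_mono)
  have "\<exists>w. w \<in> truncated_cone 3 b \<and> F_transform M w = z" if z: "z \<in> truncated_cone 1 (2 * \<beta>)" for z
  proof -
    have sub: "cball z (Im z / 2) \<subseteq> truncated_cone 3 \<beta>"
      using cball_subset_truncated_cone[OF z _ \<beta>(1)] by simp
    have pos: "Im z > 0"
      using z \<beta>(1) by (simp add: truncated_cone_iff)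
    have "\<exists>!w. w \<in> cball z (Im z / 2) \<and> z - ?u w = w"
    proof (rule Banach_fix[OF compact_imp_complete[OF compact_cball]])
      show "cball z (Im z / 2) \<noteq> {}"
        using pos by simp
      show "(\<lambda>w. z - ?u w) ` cball z (Im z / 2) \<subseteq> cball z (Im z / 2)"
      proof (rule image_subsetI)
        fix w assume w: "w \<in> cball z (Im z / 2)"
        have "cmod (?u w) \<le> 1 / 5 * cmod w"
          using w sub \<beta>(4) by (intro \<beta>2(2)) auto
        moreover have "cmod w \<le> cmod z + Im z / 2"
          using norm_triangle_ineq4[of z "z - w"] w by (simp add: dist_norm)
        moreover have "cmod z \<le> 2 * Im z"
          using cmod_le_cone[OF z] \<beta>(1) by simp
        ultimately have "cmod (?u w) \<le> Im z / 2"
          by simp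
        then show "z - ?u w \<in> cball z (Im z / 2)"
          by (simp add: dist_norm)
      qed
      show "dist (z - ?u v) (z - ?u w) \<le> 1 / 2 * dist v w"
        if "v \<in> cball z (Im z / 2)" "w \<in> cball z (Im z / 2)" for v w
      proof -
        have "cmod (?u w - ?u v) \<le> 1 / 2 * cmod (w - v)"
          using that sub \<beta>(3) by (intro \<beta>1(2)) auto
        then show ?thesis
          by (simp add: dist_norm norm_minus_commute algebra_simps)
      qed
    qed auto
    then obtain w where "w \<in> cball z (Im z / 2)" "z - ?u w = w"
      by blast
    then show ?thesis
      using sub \<beta>(2) by (intro exI[of _ w]) (auto simp: algebra_simps)
  qed
  then have "\<forall>z\<in>truncated_cone 1 (2 * \<beta>). \<exists>w. w \<in> truncated_cone 3 b \<and> F_transform M w = z"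
    by blast
  then obtain g where "\<forall>z\<in>truncated_cone 1 (2 * \<beta>). g z \<in> truncated_cone 3 b \<and> F_transform M (g z) = z"
    by (rule bchoice[THEN exE])
  then show ?thesis
    using \<beta>(1) by (intro exI[of _ "2 * \<beta>"] conjI exI[of _ g]) auto
qed

text \<open>
  An inverse with values in some cone is necessarily close to the identity along the imaginary axis: \<open>F\<close> is bounded on
  the part \<open>S\<close> of the cone at bounded height, so large arguments have preimages high up, where \<open>F w\<close> is close to \<open>w\<close>.
\<close>

lemma F_inverse_asymptotic:
  assumes g: "is_F_inverse_on M (truncated_cone \<alpha> \<beta>) g" and "\<alpha> > 0" "\<beta> > 0" and \<eta>: "\<eta> > 0"
  shows "\<exists>Y. \<forall>y\<ge>Y. cmod (g (\<i> * of_real y) - \<i> * of_real y) \<le> \<eta> * y"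
proof -
  obtain a b where ab: "a > 0" "b > 0" and ginv: "\<And>z. z \<in> truncated_cone \<alpha> \<beta> \<Longrightarrow> g z \<in> truncated_cone a b"
    "\<And>z. z \<in> truncated_cone \<alpha> \<beta> \<Longrightarrow> F_transform M (g z) = z"
    using g unfolding is_F_inverse_on_def by blast
  define \<epsilon> where "\<epsilon> = min (1 / 2) (\<eta> / 2)"
  have eps: "\<epsilon> > 0" "\<epsilon> \<le> 1 / 2" "2 * \<epsilon> \<le> \<eta>"
    using \<eta> by (auto simp: \<epsilon>_def)
  obtain \<beta>' where \<beta>': "\<And>z. z \<in> truncated_cone a \<beta>' \<Longrightarrow> cmod (F_transform M z - z) \<le> \<epsilon> * cmod z"
    using F_transform_asymptotic[OF ab(1) eps(1)] by blast
  define S where "S = {w. b \<le> Im w} \<inter> {w. Im w \<le> \<beta>'} \<inter> {w. \<bar>Re w\<bar> \<le> a * Im w}"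
  have "closed S"
    unfolding S_def by (intro closed_Int closed_Collect_le continuous_intros)
  moreover have "bounded S"
  proof (rule boundedI)
    fix w assume w: "w \<in> S"
    then have "\<bar>Im w\<bar> \<le> \<beta>'" "\<bar>Re w\<bar> \<le> a * \<beta>'"
      using ab mult_left_mono[of "Im w" \<beta>' a] by (auto simp: S_def intro: order_trans)
    then show "cmod w \<le> a * \<beta>' + \<beta>'"
      using cmod_le[of w] by linarith
  qed
  ultimately have "compact S"
    by (simp add: compact_eq_bounded_closed)
  moreover have "continuous_on S (F_transform M)"
    using holomorphic_on_imp_continuous_on[OF F_transform_holomorphic]
    by (rule continuous_on_subset) (use ab in \<open>auto simp: S_def\<close>)
  ultimately have "bounded (F_transform M ` S)"
    by (intro compact_imp_bounded compact_continuous_image)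
  then obtain L where L: "\<And>w. w \<in> S \<Longrightarrow> cmod (F_transform M w) \<le> L"
    by (auto simp: bounded_iff)
  show ?thesis
  proof (intro exI allI impI)
    fix y assume y: "y \<ge> max \<beta> L + 1"
    let ?z = "\<i> * complex_of_real y"
    have zc: "?z \<in> truncated_cone \<alpha> \<beta>"
      using y assms by (intro imaginary_axis_in_cone) auto
    have y0: "y > 0" using y assms by simp
    have "g ?z \<notin> S"
      using L[of "g ?z"] ginv(2)[OF zc] y by (auto simp: norm_mult)
    then have "g ?z \<in> truncated_cone a \<beta>'"
      using ginv(1)[OF zc] by (auto simp: S_def truncated_cone_iff)
    then have *: "cmod (?z - g ?z) \<le> \<epsilon> * cmod (g ?z)"
      using \<beta>'[of "g ?z"] ginv(2)[OF zc] by simp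
    have "cmod (g ?z) \<le> y + cmod (?z - g ?z)"
      using norm_triangle_ineq4[of ?z "?z - g ?z"] y0 by (simp add: norm_mult)
    moreover have "\<epsilon> * cmod (g ?z) \<le> 1 / 2 * cmod (g ?z)"
      using eps by (intro mult_right_mono) auto
    ultimately have "cmod (g ?z) \<le> 2 * y"
      using * by linarith
    then have "\<epsilon> * cmod (g ?z) \<le> \<epsilon> * (2 * y)"
      using eps by (intro mult_left_mono) auto
    also have "\<dots> \<le> \<eta> * y"
      using mult_right_mono[OF eps(3), of y] y0 by (simp add: mult.commute mult.left_commute)
    finally show "cmod (g ?z - ?z) \<le> \<eta> * y"
      using * by (simp add: norm_minus_commute)
  qed
qed

text \<open>
  The two inverses may take values in different cones, neither containing the other.  Along the imaginary axis both
  values are close to the axis, so eventually both lie in the same cone of injectivity.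
\<close>

lemma F_inverse_eventually_unique:
  assumes g: "is_F_inverse_on M (truncated_cone \<alpha> \<beta>) g" "\<alpha> > 0" "\<beta> > 0"
    and g': "is_F_inverse_on M (truncated_cone \<alpha>' \<beta>') g'" "\<alpha>' > 0" "\<beta>' > 0"
  shows "\<exists>Y. \<forall>y\<ge>Y. g (\<i> * of_real y) = g' (\<i> * of_real y)"
proof -
  obtain a b where ab: "a > 0" "b > 0" and inj: "inj_on (F_transform M) (truncated_cone a b)"
    and ginv: "\<And>z. z \<in> truncated_cone \<alpha> \<beta> \<Longrightarrow> g z \<in> truncated_cone a b"
    "\<And>z. z \<in> truncated_cone \<alpha> \<beta> \<Longrightarrow> F_transform M (g z) = z"
    using g(1) unfolding is_F_inverse_on_def by blast
  have g'inv: "F_transform M (g' z) = z" if "z \<in> truncated_cone \<alpha>' \<beta>'" for z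
    using g'(1) that unfolding is_F_inverse_on_def by blast
  \<comment> \<open>Points within \<open>\<eta> y\<close> of \<open>i y\<close> have height at least \<open>y / 2\<close> and lie in a cone of aperture \<open>a / 2\<close>.\<close>
  define \<eta> where "\<eta> = min (1 / 2) (a / 4)"
  have eta: "\<eta> > 0" "\<eta> \<le> 1 / 2" "\<eta> \<le> a / 4"
    using ab by (auto simp: \<eta>_def)
  obtain Y where Y: "\<And>y. y \<ge> Y \<Longrightarrow> cmod (g' (\<i> * of_real y) - \<i> * of_real y) \<le> \<eta> * y"
    using F_inverse_asymptotic[OF g' eta(1)] by blast
  show ?thesis
  proof (intro exI allI impI)
    fix y assume "y \<ge> max Y (max (2 * b) (max \<beta> \<beta>')) + 1"
    then have y: "y \<ge> Y" "y > 2 * b" "y > \<beta>" "y > \<beta>'"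
      by auto
    let ?z = "\<i> * complex_of_real y"
    have zc: "?z \<in> truncated_cone \<alpha> \<beta>" "?z \<in> truncated_cone \<alpha>' \<beta>'"
      using y g g' by (auto intro!: imaginary_axis_in_cone)
    have y0: "y > 0" using y ab by linarith
    have "cmod (g' ?z - ?z) \<le> \<eta> * y"
      by (rule Y[OF y(1)])
    moreover have "\<eta> * y \<le> 1 / 2 * y" "\<eta> * y \<le> a / 4 * y"
      using eta y0 by (auto intro!: mult_right_mono)
    ultimately have 1: "Im (g' ?z) \<ge> y / 2" and 2: "\<bar>Re (g' ?z)\<bar> \<le> a / 4 * y"
      using abs_Im_le_cmod[of "g' ?z - ?z"] abs_Re_le_cmod[of "g' ?z - ?z"] by auto
    have "a / 4 * y < a * (y / 2)"
      using ab y0 by simp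
    also have "\<dots> \<le> a * Im (g' ?z)"
      using 1 ab by (intro mult_left_mono) auto
    finally have "g' ?z \<in> truncated_cone a b"
      using 1 2 y by (simp add: truncated_cone_iff)
    then show "g ?z = g' ?z"
      by (intro inj_onD[OF inj _ ginv(1)[OF zc(1)]]) (simp_all add: ginv(2)[OF zc(1)] g'inv[OF zc(2)])
  qed
qed

end

text \<open>
  By the previous lemma the Voiculescu transforms of \<open>\<mu>\<close> and \<open>\<nu>\<close>, hence also the inverses for \<open>\<rho>\<close> and
  \<open>\<rho>'\<close>, agree high up on the imaginary axis.  The two \<open>F\<close>-transforms therefore agree on the curve \<open>\<gamma>\<close> of their
  values.  A compact piece of that curve is infinite and so accumulates inside the upper half-plane, which leaves
  the identity theorem and the injectivity of the \<open>F\<close>-transform.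
\<close>

theorem is_free_conv_unique:
  assumes \<mu>: "real_distribution \<mu>" and \<nu>: "real_distribution \<nu>"
    and 1: "is_free_conv \<mu> \<nu> \<rho>" and 2: "is_free_conv \<mu> \<nu> \<rho>'"
  shows "\<rho> = \<rho>'"
proof -
  obtain \<alpha> \<beta> g\<mu> g\<nu> g\<rho> where c: "\<alpha> > 0" "\<beta> > 0"
    and inv: "is_F_inverse_on \<mu> (truncated_cone \<alpha> \<beta>) g\<mu>" "is_F_inverse_on \<nu> (truncated_cone \<alpha> \<beta>) g\<nu>"
      "is_F_inverse_on \<rho> (truncated_cone \<alpha> \<beta>) g\<rho>"
    and sum: "\<And>z. z \<in> truncated_cone \<alpha> \<beta> \<Longrightarrow> g\<rho> z - z = (g\<mu> z - z) + (g\<nu> z - z)"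
    using 1 unfolding is_free_conv_def is_voiculescu_transform_on_def by metis
  obtain \<alpha>' \<beta>' g\<mu>' g\<nu>' g\<rho>' where c': "\<alpha>' > 0" "\<beta>' > 0"
    and inv': "is_F_inverse_on \<mu> (truncated_cone \<alpha>' \<beta>') g\<mu>'" "is_F_inverse_on \<nu> (truncated_cone \<alpha>' \<beta>') g\<nu>'"
      "is_F_inverse_on \<rho>' (truncated_cone \<alpha>' \<beta>') g\<rho>'"
    and sum': "\<And>z. z \<in> truncated_cone \<alpha>' \<beta>' \<Longrightarrow> g\<rho>' z - z = (g\<mu>' z - z) + (g\<nu>' z - z)"
    using 2 unfolding is_free_conv_def is_voiculescu_transform_on_def by metis
  have \<rho>: "real_distribution \<rho>" and \<rho>': "real_distribution \<rho>'"
    using 1 2 by (auto simp: is_free_conv_def)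
  obtain Y1 where Y1: "\<And>y. y \<ge> Y1 \<Longrightarrow> g\<mu> (\<i> * of_real y) = g\<mu>' (\<i> * of_real y)"
    using real_distribution.F_inverse_eventually_unique[OF \<mu> inv(1) c inv'(1) c'] by blast
  obtain Y2 where Y2: "\<And>y. y \<ge> Y2 \<Longrightarrow> g\<nu> (\<i> * of_real y) = g\<nu>' (\<i> * of_real y)"
    using real_distribution.F_inverse_eventually_unique[OF \<nu> inv(2) c inv'(2) c'] by blast
  obtain Y3 where Y3: "\<And>y. y \<ge> Y3 \<Longrightarrow> cmod (g\<rho> (\<i> * of_real y) - \<i> * of_real y) \<le> 1 / 2 * y"
    using real_distribution.F_inverse_asymptotic[OF \<rho> inv(3) c, of "1 / 2"] by auto
  define Y where "Y = max (max Y1 Y2) (max Y3 (max \<beta> \<beta>')) + 1"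
  define \<gamma> where "\<gamma> y = g\<rho> (\<i> * complex_of_real y)" for y
  have cone: "\<i> * complex_of_real y \<in> truncated_cone \<alpha> \<beta>" "\<i> * complex_of_real y \<in> truncated_cone \<alpha>' \<beta>'" if "y \<ge> Y" for y
    using that c c' by (auto simp: Y_def intro!: imaginary_axis_in_cone)
  have F1: "F_transform \<rho> (\<gamma> y) = \<i> * of_real y" if "y \<ge> Y" for y
    using inv(3) cone(1)[OF that] by (auto simp: is_F_inverse_on_def \<gamma>_def)
  have F2: "F_transform \<rho>' (\<gamma> y) = \<i> * of_real y" if "y \<ge> Y" for y
  proof -
    let ?z = "\<i> * complex_of_real y"
    have "y \<ge> Y1" "y \<ge> Y2"
      using that by (auto simp: Y_def)
    then have "g\<rho> ?z - ?z = g\<rho>' ?z - ?z"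
      by (simp only: sum[OF cone(1)[OF that]] sum'[OF cone(2)[OF that]] Y1 Y2)
    then have "\<gamma> y = g\<rho>' ?z"
      by (simp add: \<gamma>_def)
    then show ?thesis
      using inv'(3) cone(2)[OF that] by (auto simp: is_F_inverse_on_def)
  qed
  have Y0: "Y > 0" using c by (simp add: Y_def)
  let ?U = "\<gamma> ` {Y..Y + 1}"
  let ?K = "{w. Y / 2 \<le> Im w} \<inter> cball 0 (2 * (Y + 1))"
  have "inj_on \<gamma> {Y..Y + 1}"
  proof (rule inj_onI)
    fix x y assume xy: "x \<in> {Y..Y + 1}" "y \<in> {Y..Y + 1}" and eq: "\<gamma> x = \<gamma> y"
    have "x \<ge> Y" "y \<ge> Y"
      using xy by auto
    from F1[OF this(1)] F1[OF this(2)] have "\<i> * complex_of_real x = \<i> * of_real y"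
      by (simp only: eq)
    then show "x = y"
      by simp
  qed
  then have inf: "infinite ?U"
    by (simp add: finite_image_iff infinite_Icc)
  have sub: "?U \<subseteq> ?K"
  proof (rule image_subsetI)
    fix y assume y: "y \<in> {Y..Y + 1}"
    then have d: "cmod (\<gamma> y - \<i> * of_real y) \<le> 1 / 2 * y"
    proof -
      have "y \<ge> Y3"
        using y by (auto simp: Y_def)
      then show ?thesis
        unfolding \<gamma>_def by (rule Y3)
    qed
    have "Im (\<gamma> y) \<ge> Y / 2"
      using abs_Im_le_cmod[of "\<gamma> y - \<i> * of_real y"] d y by auto
    moreover have "cmod (\<gamma> y) \<le> 2 * (Y + 1)"
      using norm_triangle_ineq[of "\<gamma> y - \<i> * of_real y" "\<i> * of_real y"] d y Y0 by (simp add: norm_mult)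
    ultimately show "\<gamma> y \<in> ?K"
      by simp
  qed
  have "closed {w. Y / 2 \<le> Im w}"
    by (intro closed_Collect_le continuous_intros)
  then have "compact ?K"
    by (intro closed_Int_compact) auto
  then obtain \<xi> where \<xi>: "\<xi> \<in> ?K" "\<xi> islimpt ?U"
    using Heine_Borel_imp_Bolzano_Weierstrass[OF _ inf sub] by blast
  have "F_transform \<rho> w - F_transform \<rho>' w = 0" if "Im w > 0" for w
  proof (rule analytic_continuation[of "\<lambda>w. F_transform \<rho> w - F_transform \<rho>' w" "half_plane 0" ?U \<xi>])
    show "(\<lambda>w. F_transform \<rho> w - F_transform \<rho>' w) holomorphic_on half_plane 0"
      by (intro holomorphic_intros real_distribution.F_transform_holomorphic \<rho> \<rho>')
    show "connected (half_plane 0)"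
      by (intro convex_connected convex_half_plane)
    show "?U \<subseteq> half_plane 0"
      using sub Y0 by auto
    show "F_transform \<rho> z - F_transform \<rho>' z = 0" if "z \<in> ?U" for z
      using that F1 F2 by auto
  qed (use \<xi> Y0 that open_half_plane in auto)
  then show ?thesis
    by (intro F_transform_unique[OF \<rho> \<rho>']) auto
qed

lemma free_conv_eqI:
  assumes "real_distribution \<mu>" "real_distribution \<nu>" "is_free_conv \<mu> \<nu> \<rho>"
  shows "\<mu> \<boxplus> \<nu> = \<rho>"
  unfolding free_conv_def using assms is_free_conv_unique by (intro the_equality) blast+

section \<open>The subordination function\<close>

text \<open>
  \<open>\<bar>w - l'\<bar>\<^sup>2 - \<bar>w - l\<bar>\<^sup>2 = 4 (Im l - s) (Im w - s)\<close>: the points above the line \<open>Im w = s\<close> are those closer to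
  \<open>l\<close> than to its reflection \<open>l'\<close>.
\<close>

lemma Cayley_quotient_less_1:
  assumes "Im l > s" "Im w > s"
  defines "l' \<equiv> cnj l + 2 * \<i> * complex_of_real s"
  shows "w - l' \<noteq> 0" and "cmod ((w - l) / (w - l')) < 1"
proof -
  show nz: "w - l' \<noteq> 0"
    using assms by (auto simp: complex_eq_iff)
  have "(cmod (w - l))\<^sup>2 = (cmod (w - l'))\<^sup>2 - 4 * (Im l - s) * (Im w - s)"
    unfolding cmod_power2 by (simp add: l'_def power2_eq_square algebra_simps)
  moreover have "(Im l - s) * (Im w - s) > 0"
    using assms by simp
  ultimately have "(cmod (w - l))\<^sup>2 < (cmod (w - l'))\<^sup>2"
    by linarith
  then have "cmod (w - l) < cmod (w - l')"
    by (rule power2_less_imp_less) simp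
  then show "cmod ((w - l) / (w - l')) < 1"
    using nz by (simp add: norm_divide)
qed

lemma Cayley_inverse_half_plane:
  assumes l: "Im l > s" and \<zeta>: "cmod \<zeta> < 1"
  defines "l' \<equiv> cnj l + 2 * \<i> * complex_of_real s"
  defines "w \<equiv> (l - \<zeta> * l') / (1 - \<zeta>)"
  shows "Im w > s" and "(w - l) / (w - l') = \<zeta>"
proof -
  have ne: "\<zeta> \<noteq> 1"
    using \<zeta> by auto
  have ll: "l - l' \<noteq> 0"
    using l by (auto simp: l'_def complex_eq_iff)
  have 1: "w - l = \<zeta> * (l - l') / (1 - \<zeta>)" and 2: "w - l' = (l - l') / (1 - \<zeta>)"
    using ne by (simp_all add: w_def field_simps)
  show q: "(w - l) / (w - l') = \<zeta>"
    unfolding 1 2 using ne ll by simp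
  have "w - l' \<noteq> 0"
    unfolding 2 using ne ll by simp
  then have "w - l = \<zeta> * (w - l')"
    using q by (simp add: field_simps)
  then have "cmod (w - l) < cmod (w - l')"
    using \<zeta> \<open>w - l' \<noteq> 0\<close> by (simp add: norm_mult)
  then have "(cmod (w - l))\<^sup>2 < (cmod (w - l'))\<^sup>2"
    by (intro power_strict_mono) auto
  moreover have "(cmod (w - l))\<^sup>2 = (cmod (w - l'))\<^sup>2 - 4 * (Im l - s) * (Im w - s)"
    unfolding cmod_power2 by (simp add: l'_def power2_eq_square algebra_simps)
  ultimately have "(Im l - s) * (Im w - s) > 0"
    by linarith
  then show "Im w > s"
    using l by (simp add: zero_less_mult_iff)
qed

text \<open>
  A special case of the Earle-Hamilton theorem: the image lies in a disc which is compact in the half-plane, so the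
  map is a strict contraction of the hyperbolic metric.  Concretely, Brouwer's theorem provides a fixed
  point \<open>l\<close>, the Cayley quotient \<open>c\<close> sends the half-plane to the unit disc and \<open>l\<close> to \<open>0\<close>, and there the Schwarz
  lemma, applied after division by a bound \<open>k < 1\<close> for the image, gives \<open>\<bar>c (f w)\<bar> \<le> k \<bar>c w\<bar>\<close>.
\<close>

theorem half_plane_self_map_iterates_converge:
  assumes f: "f holomorphic_on half_plane s"
    and maps: "\<And>w. Im w > s \<Longrightarrow> f w \<in> cball p r"
    and r: "r < Im p - s"
  shows "\<exists>l. Im l > s \<and> f l = l \<and> (\<forall>w. Im w > s \<longrightarrow> (\<lambda>n. (f ^^ n) w) \<longlonglongrightarrow> l)"
proof -
  \<comment> \<open>A slightly larger radius, positive even when \<open>r = 0\<close>, as Brouwer's theorem needs a ball with interior.\<close>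
  define R where "R = (max r 0 + (Im p - s)) / 2"
  have p: "Im p > s"
  proof -
    have "f (\<i> * of_real (s + 1)) \<in> cball p r"
      by (rule maps) simp
    then have "r \<ge> 0"
      unfolding mem_cball by (rule order_trans[OF zero_le_dist])
    then show ?thesis using r by simp
  qed
  then have R: "R > 0" "r \<le> R" "R < Im p - s"
    using r by (auto simp: R_def)
  have sub: "cball p R \<subseteq> half_plane s"
  proof
    fix w assume "w \<in> cball p R"
    then show "w \<in> half_plane s"
      using abs_Im_le_cmod[of "p - w"] R by (auto simp: dist_norm)
  qed
  have mapsR: "f w \<in> cball p R" if "Im w > s" for w
    using maps[OF that] R by auto
  obtain l where lR: "l \<in> cball p R" and fl: "f l = l"
  proof (rule brouwer_ball[OF R(1)])
    show "continuous_on (cball p R) f"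
      using holomorphic_on_imp_continuous_on[OF f] sub by (rule continuous_on_subset)
    show "f \<in> cball p R \<rightarrow> cball p R"
      using mapsR sub by auto
  qed blast
  have l: "Im l > s"
    using lR sub by auto
  \<comment> \<open>The reflection of \<open>l\<close> in the boundary line \<open>Im w = s\<close>.\<close>
  define l' where "l' = cnj l + 2 * \<i> * complex_of_real s"
  define c where "c w = (w - l) / (w - l')" for w
  define \<psi> where "\<psi> \<zeta> = (l - \<zeta> * l') / (1 - \<zeta>)" for \<zeta>
  have cnz: "w - l' \<noteq> 0" and c1: "cmod (c w) < 1" if "Im w > s" for w
    using Cayley_quotient_less_1[OF l that] by (simp_all add: l'_def c_def)
  have \<psi>: "Im (\<psi> \<zeta>) > s" "c (\<psi> \<zeta>) = \<zeta>" if "cmod \<zeta> < 1" for \<zeta>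
    using Cayley_inverse_half_plane[OF l that] by (simp_all add: l'_def c_def \<psi>_def)
  have \<psi>c: "\<psi> (c w) = w" if "Im w > s" for w
  proof -
    have ll: "l - l' \<noteq> 0"
      using l by (auto simp: l'_def complex_eq_iff)
    have "1 - c w = (l - l') / (w - l')"
      using cnz[OF that] by (simp add: c_def field_simps)
    moreover have "l - c w * l' = w * (l - l') / (w - l')"
      using cnz[OF that] by (simp add: c_def field_simps)
    ultimately show ?thesis
      using cnz[OF that] ll by (simp add: \<psi>_def)
  qed
  have "w - l' \<noteq> 0" if "w \<in> cball p R" for w
    using cnz subsetD[OF sub that] half_plane_iff by blast
  then have "continuous_on (cball p R) (\<lambda>w. cmod (c w))"
    unfolding c_def by (intro continuous_intros) blast
  then obtain w0 where w0: "w0 \<in> cball p R" "\<And>w. w \<in> cball p R \<Longrightarrow> cmod (c w) \<le> cmod (c w0)"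
    using continuous_attains_sup[of "cball p R" "\<lambda>w. cmod (c w)"] R(1) by auto
  define k where "k = (1 + cmod (c w0)) / 2"
  have k: "cmod (c w0) < k" "k < 1" "k > 0"
    using c1[of w0] w0(1) sub by (auto simp: k_def add_pos_nonneg)
  have contr: "cmod (c (f w)) \<le> k * cmod (c w)" if w: "Im w > s" for w
  proof -
    let ?h = "\<lambda>\<zeta>. c (f (\<psi> \<zeta>)) / of_real k"
    have "\<psi> holomorphic_on ball 0 1"
      unfolding \<psi>_def by (intro holomorphic_intros) auto
    then have f\<psi>: "(\<lambda>\<zeta>. f (\<psi> \<zeta>)) holomorphic_on ball 0 1"
      using f by (rule holomorphic_on_compose_gen[unfolded o_def]) (use \<psi>(1) in auto)
    have "c holomorphic_on half_plane s"
      unfolding c_def using cnz half_plane_iff by (intro holomorphic_intros) blast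
    then have "(\<lambda>\<zeta>. c (f (\<psi> \<zeta>))) holomorphic_on ball 0 1"
    proof (rule holomorphic_on_compose_gen[OF f\<psi>, unfolded o_def])
      show "(\<lambda>\<zeta>. f (\<psi> \<zeta>)) ` ball 0 1 \<subseteq> half_plane s"
        using subsetD[OF sub mapsR[OF \<psi>(1)]] by auto
    qed
    then have hol: "?h holomorphic_on ball 0 1"
      using k(3) by (intro holomorphic_intros) auto
    have "norm (?h (c w)) \<le> norm (c w)"
    proof (rule Schwarz_Lemma(1)[OF hol])
      show "?h 0 = 0"
        by (simp add: \<psi>_def fl) (simp add: c_def)
      show "norm (?h \<zeta>) < 1" if "norm \<zeta> < 1" for \<zeta>
      proof -
        have "cmod (c (f (\<psi> \<zeta>))) < k"
          using w0(2)[OF mapsR[OF \<psi>(1)[OF that]]] k(1) by linarith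
        then show ?thesis
          using k(3) by (simp add: norm_divide)
      qed
      show "norm (c w) < 1"
        by (rule c1[OF w])
    qed
    then show ?thesis
      using k(3) by (simp add: norm_divide \<psi>c[OF w] pos_divide_le_eq mult.commute)
  qed
  have "(\<lambda>n. (f ^^ n) w) \<longlonglongrightarrow> l" if w: "Im w > s" for w
  proof -
    have inH: "Im ((f ^^ n) w) > s" for n
    proof (induction n)
      case (Suc n)
      show ?case
        using subsetD[OF sub mapsR[OF Suc]] by simp
    qed (use w in simp)
    have it: "cmod (c ((f ^^ n) w)) \<le> k ^ n" for n
    proof (induction n)
      case 0
      then show ?case using c1[OF w] by simp
    next
      case (Suc n)
      have "cmod (c ((f ^^ Suc n) w)) \<le> k * cmod (c ((f ^^ n) w))"
        using contr[OF inH[of n]] by simp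
      also have "\<dots> \<le> k * k ^ n"
        using Suc k by (intro mult_left_mono) auto
      finally show ?case by simp
    qed
    have bd: "cmod ((f ^^ Suc n) w - l') \<le> cmod p + R + cmod l'" for n
    proof -
      have "cmod (p - (f ^^ Suc n) w) \<le> R"
        using mapsR[OF inH[of n]] by (simp add: dist_norm)
      moreover have "cmod ((f ^^ Suc n) w - l') \<le> cmod ((f ^^ Suc n) w) + cmod l'"
        by (rule norm_triangle_ineq4)
      moreover have "cmod ((f ^^ Suc n) w) \<le> cmod p + cmod (p - (f ^^ Suc n) w)"
        using norm_triangle_ineq4[of p "p - (f ^^ Suc n) w"] by simp
      ultimately show ?thesis by linarith
    qed
    have "(\<lambda>n. (f ^^ Suc n) w - l) \<longlonglongrightarrow> 0"
    proof (rule Lim_null_comparison)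
      show "eventually (\<lambda>n. norm ((f ^^ Suc n) w - l) \<le> (cmod p + R + cmod l') * k ^ Suc n) sequentially"
      proof (rule always_eventually, rule allI)
        fix n
        have "(f ^^ Suc n) w - l = ((f ^^ Suc n) w - l') * c ((f ^^ Suc n) w)"
          using cnz[OF inH[of "Suc n"]] by (simp add: c_def del: funpow.simps)
        then have "norm ((f ^^ Suc n) w - l) = cmod ((f ^^ Suc n) w - l') * cmod (c ((f ^^ Suc n) w))"
          by (simp only: norm_mult)
        also have "\<dots> \<le> (cmod p + R + cmod l') * k ^ Suc n"
          using R(1) by (intro mult_mono bd it) auto
        finally show "norm ((f ^^ Suc n) w - l) \<le> (cmod p + R + cmod l') * k ^ Suc n" .
      qed
      have "(\<lambda>n. k ^ Suc n) \<longlonglongrightarrow> 0"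
        by (rule LIMSEQ_Suc) (use k in \<open>auto intro!: LIMSEQ_realpow_zero\<close>)
      then show "(\<lambda>n. (cmod p + R + cmod l') * k ^ Suc n) \<longlonglongrightarrow> 0"
        by (rule tendsto_mult_right_zero)
    qed
    then have "(\<lambda>n. (f ^^ Suc n) w) \<longlonglongrightarrow> l"
      using Lim_null by blast
    then show ?thesis
      by (rule LIMSEQ_imp_Suc)
  qed
  then show ?thesis
    using l fl by blast
qed

locale subordination =
  M1: real_distribution \<mu>\<^sub>1 + M3: real_distribution \<mu>\<^sub>3
  for \<mu>\<^sub>1 \<mu>\<^sub>3 :: "real measure" +
  fixes \<sigma>\<^sub>1 :: real
  assumes square_integrable: "integrable \<mu>\<^sub>1 (\<lambda>x. x\<^sup>2)" "integrable \<mu>\<^sub>3 (\<lambda>x. x\<^sup>2)"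
    and sigma_nonneg: "\<sigma>\<^sub>1 \<ge> 0" and sigma_variance: "\<sigma>\<^sub>1\<^sup>2 = M1.variance (\<lambda>x. x)"
begin

definition c :: real where "c = 2 * sqrt 2 * \<sigma>\<^sub>1"

definition m :: real where "m = M1.expectation (\<lambda>x. x)"

lemma c_nonneg: "c \<ge> 0"
  using sigma_nonneg by (simp add: c_def)

lemma sigma_power2: "\<sigma>\<^sub>1\<^sup>2 = c\<^sup>2 / 8"
  by (simp add: c_def power_mult_distrib)

lemma h_fun_near_mean:
  assumes "Im b > 0"
  shows "cmod (h_fun \<mu>\<^sub>1 b - of_real m) \<le> c\<^sup>2 / 8 / Im b"
  using M1.F_transform_near_shift[OF square_integrable(1) assms] sigma_variance sigma_power2
  by (simp add: h_fun_def m_def algebra_simps)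

lemma Im_h_tilde: "Im w > 0 \<Longrightarrow> Im (h_tilde \<mu>\<^sub>3 w) \<ge> 2 * Im w"
  using M3.Im_F_transform_ge[of w] by (simp add: h_tilde_def)

text \<open>
  The source of the constant \<open>2 sqrt 2\<close>.  Above the height \<open>3/4 Im z\<close> the argument of \<open>h\<^sub>1\<close> has imaginary part
  at least \<open>Im z / 2\<close>, hence \<open>T\<^sub>z\<close> stays within \<open>2 \<sigma>\<^sub>1\<^sup>2 / Im z\<close> of the point \<open>z + m\<close>, which lies \<open>Im z / 4\<close> above the
  boundary.  The first number is smaller than the second exactly when \<open>Im z > 2 sqrt 2 \<sigma>\<^sub>1\<close>.
\<close>

lemma T_map_near:
  assumes z: "Im z > c" and w: "Im w > 3 / 4 * Im z"
  shows "Im (h_tilde \<mu>\<^sub>3 w - z) > Im z / 2"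
    and "cmod (T_map \<mu>\<^sub>1 \<mu>\<^sub>3 z w - (z + of_real m)) \<le> c\<^sup>2 / 4 / Im z"
proof -
  have z0: "Im z > 0"
    using z c_nonneg by simp
  show b: "Im (h_tilde \<mu>\<^sub>3 w - z) > Im z / 2"
    using Im_h_tilde[of w] w z0 by simp
  have "cmod (T_map \<mu>\<^sub>1 \<mu>\<^sub>3 z w - (z + of_real m)) \<le> c\<^sup>2 / 8 / Im (h_tilde \<mu>\<^sub>3 w - z)"
    using h_fun_near_mean[of "h_tilde \<mu>\<^sub>3 w - z"] b z0 by (simp add: T_map_def)
  also have "\<dots> \<le> c\<^sup>2 / 8 / (Im z / 2)"
    using b z0 by (intro divide_left_mono) auto
  finally show "cmod (T_map \<mu>\<^sub>1 \<mu>\<^sub>3 z w - (z + of_real m)) \<le> c\<^sup>2 / 4 / Im z"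
    by simp
qed

lemma radius_less:
  assumes z: "Im z > c"
  shows "c\<^sup>2 / 4 / Im z < Im z / 4"
proof -
  have "c\<^sup>2 < (Im z)\<^sup>2"
    using z c_nonneg by (intro power_strict_mono) auto
  then show ?thesis
    using z c_nonneg by (simp add: field_simps power2_eq_square)
qed

lemma T_map_holomorphic:
  assumes z: "Im z > c"
  shows "T_map \<mu>\<^sub>1 \<mu>\<^sub>3 z holomorphic_on half_plane (3 / 4 * Im z)"
proof -
  have z0: "Im z > 0"
    using z c_nonneg by simp
  have F3: "F_transform \<mu>\<^sub>3 holomorphic_on half_plane (3 / 4 * Im z)"
    using M3.F_transform_holomorphic by (rule holomorphic_on_subset) (use z0 in auto)
  then have inner: "h_tilde \<mu>\<^sub>3 holomorphic_on half_plane (3 / 4 * Im z)"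
    unfolding h_tilde_def[abs_def] by (intro holomorphic_intros)
  have "(\<lambda>w. F_transform \<mu>\<^sub>1 (h_tilde \<mu>\<^sub>3 w - z)) holomorphic_on half_plane (3 / 4 * Im z)"
    using T_map_near(1)[OF z] z0 inner
    by (intro holomorphic_on_compose_gen[OF holomorphic_on_diff[OF inner holomorphic_on_const] M1.F_transform_holomorphic, unfolded o_def])
       (force simp del: minus_complex.simps)
  then show ?thesis
    unfolding T_map_def h_fun_def using inner by (intro holomorphic_intros)
qed

lemma w3_fixed_point:
  assumes z: "Im z > c"
  shows "Im (w3 \<mu>\<^sub>1 \<mu>\<^sub>3 z) > 3 / 4 * Im z"
    and "T_map \<mu>\<^sub>1 \<mu>\<^sub>3 z (w3 \<mu>\<^sub>1 \<mu>\<^sub>3 z) = w3 \<mu>\<^sub>1 \<mu>\<^sub>3 z"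
    and "(\<lambda>n. (T_map \<mu>\<^sub>1 \<mu>\<^sub>3 z ^^ n) z) \<longlonglongrightarrow> w3 \<mu>\<^sub>1 \<mu>\<^sub>3 z"
proof -
  have z0: "Im z > 0"
    using z c_nonneg by simp
  have "\<exists>l. Im l > 3 / 4 * Im z \<and> T_map \<mu>\<^sub>1 \<mu>\<^sub>3 z l = l \<and>
      (\<forall>w. Im w > 3 / 4 * Im z \<longrightarrow> (\<lambda>n. (T_map \<mu>\<^sub>1 \<mu>\<^sub>3 z ^^ n) w) \<longlonglongrightarrow> l)"
  proof (rule half_plane_self_map_iterates_converge[OF T_map_holomorphic[OF z]])
    show "T_map \<mu>\<^sub>1 \<mu>\<^sub>3 z w \<in> cball (z + of_real m) (c\<^sup>2 / 4 / Im z)" if "Im w > 3 / 4 * Im z" for w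
      using T_map_near(2)[OF z that] by (simp add: dist_norm norm_minus_commute)
    show "c\<^sup>2 / 4 / Im z < Im (z + of_real m) - 3 / 4 * Im z"
      using radius_less[OF z] by simp
  qed
  then obtain l where l: "Im l > 3 / 4 * Im z" "T_map \<mu>\<^sub>1 \<mu>\<^sub>3 z l = l"
    "\<And>w. Im w > 3 / 4 * Im z \<Longrightarrow> (\<lambda>n. (T_map \<mu>\<^sub>1 \<mu>\<^sub>3 z ^^ n) w) \<longlonglongrightarrow> l"
    by blast
  have zz: "Im z > 3 / 4 * Im z"
    using z0 by simp
  have "w3 \<mu>\<^sub>1 \<mu>\<^sub>3 z = l"
    unfolding w3_def
  proof (rule the_equality)
    show "Im l > 0 \<and> (\<forall>w. Im w > 3 / 4 * Im z \<longrightarrow> (\<lambda>n. (T_map \<mu>\<^sub>1 \<mu>\<^sub>3 z ^^ n) w) \<longlonglongrightarrow> l)"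
      using l z0 by auto
    show "l' = l" if "Im l' > 0 \<and> (\<forall>w. Im w > 3 / 4 * Im z \<longrightarrow> (\<lambda>n. (T_map \<mu>\<^sub>1 \<mu>\<^sub>3 z ^^ n) w) \<longlonglongrightarrow> l')" for l'
      using that l(3)[OF zz] zz LIMSEQ_unique by blast
  qed
  then show "Im (w3 \<mu>\<^sub>1 \<mu>\<^sub>3 z) > 3 / 4 * Im z"
    and "T_map \<mu>\<^sub>1 \<mu>\<^sub>3 z (w3 \<mu>\<^sub>1 \<mu>\<^sub>3 z) = w3 \<mu>\<^sub>1 \<mu>\<^sub>3 z"
    and "(\<lambda>n. (T_map \<mu>\<^sub>1 \<mu>\<^sub>3 z ^^ n) z) \<longlonglongrightarrow> w3 \<mu>\<^sub>1 \<mu>\<^sub>3 z"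
    using l zz by auto
qed

lemma w3_near:
  assumes z: "Im z > c"
  shows "cmod (w3 \<mu>\<^sub>1 \<mu>\<^sub>3 z - (z + of_real m)) \<le> c / 4"
proof -
  have "cmod (w3 \<mu>\<^sub>1 \<mu>\<^sub>3 z - (z + of_real m)) \<le> c\<^sup>2 / 4 / Im z"
    using T_map_near(2)[OF z w3_fixed_point(1)[OF z]] w3_fixed_point(2)[OF z] by simp
  also have "c * c \<le> c * Im z"
    using z c_nonneg by (intro mult_left_mono) auto
  then have "c\<^sup>2 / 4 / Im z \<le> c / 4"
    using z c_nonneg by (simp add: field_simps power2_eq_square)
  finally show ?thesis .
qed

text \<open>
  The iterates started at \<open>z\<close> itself are holomorphic in \<open>z\<close> and locally bounded, so by Montel's theorem a subsequence
  converges locally uniformly; its limit must be the pointwise limit.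
\<close>

lemma w3_holomorphic: "w3 \<mu>\<^sub>1 \<mu>\<^sub>3 holomorphic_on half_plane c"
proof -
  define f where "f n z = (T_map \<mu>\<^sub>1 \<mu>\<^sub>3 z ^^ n) z" for n z
  have f0: "f 0 z = z" and fS: "f (Suc n) z = T_map \<mu>\<^sub>1 \<mu>\<^sub>3 z (f n z)" for n z
    by (simp_all add: f_def)
  have near: "Im (f n z) > 3 / 4 * Im z \<and> cmod (f n z) \<le> 2 * cmod z + \<bar>m\<bar>" if z: "Im z > c" for n z
  proof (induction n)
    case 0
    then show ?case
      using z c_nonneg by (simp add: f0)
  next
    case (Suc n)
    \<comment> \<open>The disc of radius \<open>Im z / 4\<close> around \<open>z + m\<close> contains every later iterate.\<close>
    have d: "cmod (f (Suc n) z - (z + of_real m)) < Im z / 4"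
      unfolding fS using T_map_near(2)[OF z] Suc radius_less[OF z] by fastforce
    have "Im (f (Suc n) z) > 3 / 4 * Im z"
      using abs_Im_le_cmod[of "f (Suc n) z - (z + of_real m)"] d by simp
    moreover have "cmod (f (Suc n) z) \<le> cmod (f (Suc n) z - (z + of_real m)) + cmod (z + of_real m)"
      using norm_triangle_ineq[of "f (Suc n) z - (z + of_real m)" "z + of_real m"] by simp
    moreover have "cmod (z + of_real m) \<le> cmod z + \<bar>m\<bar>"
      using norm_triangle_ineq[of z "of_real m"] by simp
    moreover have "Im z \<le> cmod z"
      using abs_Im_le_cmod[of z] by simp
    ultimately show ?case
      using d norm_ge_zero[of z] by (intro conjI) linarith+
  qed
  have hol: "f n holomorphic_on half_plane c" for n
  proof (induction n)
    case 0
    then show ?case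
      by (simp add: f0[abs_def])
  next
    case (Suc n)
    have pos: "Im (f n z) > 0" if "Im z > c" for z
      using near[OF that, of n] that c_nonneg by linarith
    have F3: "(\<lambda>z. F_transform \<mu>\<^sub>3 (f n z)) holomorphic_on half_plane c"
      using pos by (intro holomorphic_on_compose_gen[OF Suc M3.F_transform_holomorphic, unfolded o_def]) auto
    have inner: "(\<lambda>z. h_tilde \<mu>\<^sub>3 (f n z)) holomorphic_on half_plane c"
      unfolding h_tilde_def using F3 Suc by (intro holomorphic_intros)
    have innerpos: "Im (h_tilde \<mu>\<^sub>3 (f n z) - z) > 0" if "Im z > c" for z
      using T_map_near(1)[OF that, of "f n z"] near[OF that, of n] that c_nonneg by linarith
    have "(\<lambda>z. F_transform \<mu>\<^sub>1 (h_tilde \<mu>\<^sub>3 (f n z) - z)) holomorphic_on half_plane c"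
      using innerpos
      by (intro holomorphic_on_compose_gen[OF holomorphic_on_diff[OF inner holomorphic_on_ident] M1.F_transform_holomorphic, unfolded o_def])
         (auto simp del: minus_complex.simps)
    then show ?case
      unfolding fS[abs_def] T_map_def h_fun_def using inner by (intro holomorphic_intros)
  qed
  obtain g r where g: "g holomorphic_on half_plane c" and r: "strict_mono (r :: nat \<Rightarrow> nat)"
    and lim: "\<And>z. z \<in> half_plane c \<Longrightarrow> (\<lambda>n. f (r n) z) \<longlonglongrightarrow> g z"
  proof (rule Montel[of "half_plane c" "range f" f])
    show "\<exists>B. \<forall>h\<in>range f. \<forall>z\<in>K. cmod (h z) \<le> B" if K: "compact K" "K \<subseteq> half_plane c" for K
    proof -
      obtain B where B: "\<And>z. z \<in> K \<Longrightarrow> cmod z \<le> B"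
        using compact_imp_bounded[OF K(1)] by (auto simp: bounded_iff)
      have "cmod (f n z) \<le> 2 * B + \<bar>m\<bar>" if "z \<in> K" for n z
        using near[of z n] B[OF that] K(2) that by fastforce
      then show ?thesis by blast
    qed
  qed (use hol open_half_plane in auto)
  have "g z = w3 \<mu>\<^sub>1 \<mu>\<^sub>3 z" if "z \<in> half_plane c" for z
  proof -
    have "(\<lambda>n. f n z) \<longlonglongrightarrow> w3 \<mu>\<^sub>1 \<mu>\<^sub>3 z"
      unfolding f_def using w3_fixed_point(3)[of z] that by simp
    then have "(\<lambda>n. f (r n) z) \<longlonglongrightarrow> w3 \<mu>\<^sub>1 \<mu>\<^sub>3 z"
      using LIMSEQ_subseq_LIMSEQ[OF _ r] by (auto simp: o_def)
    then show ?thesis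
      using lim[OF that] LIMSEQ_unique by blast
  qed
  then show ?thesis
    using holomorphic_transform[OF g] by blast
qed

text \<open>
  The fixed point equation solved for \<open>F\<^sub>1 a\<close>.
\<close>

lemma subordination_identity:
  assumes z: "Im z > c"
  defines "a \<equiv> F_transform \<mu>\<^sub>3 (w3 \<mu>\<^sub>1 \<mu>\<^sub>3 z) + w3 \<mu>\<^sub>1 \<mu>\<^sub>3 z - z"
  shows "F_transform \<mu>\<^sub>1 a = F_transform \<mu>\<^sub>3 (w3 \<mu>\<^sub>1 \<mu>\<^sub>3 z)"
  using w3_fixed_point(2)[OF z] by (simp add: T_map_def h_fun_def h_tilde_def a_def algebra_simps)

end

section \<open>The two free convolutions\<close>

lemma is_F_inverse_onI:
  assumes "\<alpha> > 0" "\<beta> > 0" "inj_on (F_transform \<mu>) (truncated_cone \<alpha> \<beta>)"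
    and "\<And>z. z \<in> D \<Longrightarrow> g z \<in> truncated_cone \<alpha> \<beta>" "\<And>z. z \<in> D \<Longrightarrow> F_transform \<mu> (g z) = z"
  shows "is_F_inverse_on \<mu> D g"
  unfolding is_F_inverse_on_def using assms by blast

lemma is_free_convI:
  assumes "real_distribution \<rho>" "\<alpha> > 0" "\<beta> > 0"
    and "is_F_inverse_on \<mu> (truncated_cone \<alpha> \<beta>) g" "is_F_inverse_on \<nu> (truncated_cone \<alpha> \<beta>) h"
    and "is_F_inverse_on \<rho> (truncated_cone \<alpha> \<beta>) k"
    and "\<And>z. z \<in> truncated_cone \<alpha> \<beta> \<Longrightarrow> k z - z = (g z - z) + (h z - z)"
  shows "is_free_conv \<mu> \<nu> \<rho>"
proof -
  let ?D = "truncated_cone \<alpha> \<beta>"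
  have v: "is_voiculescu_transform_on \<kappa> ?D (\<lambda>z. f z - z)" if "is_F_inverse_on \<kappa> ?D f" for \<kappa> f
    unfolding is_voiculescu_transform_on_def using that by blast
  have "\<forall>z\<in>?D. k z - z = (g z - z) + (h z - z)"
    by (intro ballI assms(7))
  then show ?thesis
    unfolding is_free_conv_def using assms(1-3) v[OF assms(4)] v[OF assms(5)] v[OF assms(6)] by blast
qed

lemma truncated_cone_1_subset_3: "\<beta> > 0 \<Longrightarrow> truncated_cone 1 \<beta> \<subseteq> truncated_cone 3 \<beta>"
  by (auto simp: truncated_cone_iff)

text \<open>
  If \<open>g\<close> inverts the \<open>F\<close>-transform of \<open>\<mu>\<close>, then \<open>g - i c\<close> inverts that of \<open>\<rho>\<close>, and \<open>z - i c\<close> inverts that of the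
  Cauchy distribution.  The rest is the choice of cones in which all three inverses take their values.
\<close>

lemma is_free_conv_cauchy_distribution:
  assumes \<mu>: "real_distribution \<mu>" and \<rho>: "real_distribution \<rho>" and c: "c \<ge> 0"
    and F\<rho>: "\<And>z. Im z > 0 \<Longrightarrow> F_transform \<rho> z = F_transform \<mu> (z + \<i> * of_real c)"
  shows "is_free_conv \<mu> (cauchy_distribution c) \<rho>"
proof -
  obtain b1 where b1: "b1 > 0" "inj_on (F_transform \<mu>) (truncated_cone 3 b1)"
    using real_distribution.F_transform_inj_on_cone[OF \<mu>, of 3] by auto
  obtain b2 where b2: "b2 > 0" "inj_on (F_transform \<rho>) (truncated_cone 4 b2)"
    using real_distribution.F_transform_inj_on_cone[OF \<rho>, of 4] by auto
  define b where "b = max b1 (b2 + 5 * c)"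
  have b: "b > 0" "b \<ge> b1" "b \<ge> 5 * c" "b - c \<ge> b2"
    using b1 b2 c by (auto simp: b_def)
  obtain B g where B: "B > 0" and g: "\<And>z. z \<in> truncated_cone 1 B \<Longrightarrow> g z \<in> truncated_cone 3 b"
    "\<And>z. z \<in> truncated_cone 1 B \<Longrightarrow> F_transform \<mu> (g z) = z"
    using real_distribution.F_transform_right_inverse[OF \<mu> b(1)] by blast
  define B' where "B' = max B (5 * c)"
  have B': "B' \<ge> B" "B' \<ge> 5 * c" "B' - c > 0"
    using B c by (auto simp: B'_def max_def)
  have sub: "truncated_cone 1 B' \<subseteq> truncated_cone 1 B"
    by (rule truncated_cone_mono[OF B'(1)])
  have near: "cmod (z - \<i> * of_real c - z) \<le> c" for z
    using c by (simp add: norm_mult)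
  have k: "z - \<i> * of_real c \<in> truncated_cone 4 (B' - c)" if "z \<in> truncated_cone 1 B'" for z
  proof (rule shift_into_truncated_cone[OF _ near B'(2)])
    have "B' > 0"
      using B' B by linarith
    then show "z \<in> truncated_cone 3 B'"
      using subsetD[OF truncated_cone_1_subset_3 that] by blast
  qed
  have gk: "g z - \<i> * of_real c \<in> truncated_cone 4 (b - c)" if "z \<in> truncated_cone 1 B'" for z
    using that sub g(1) b by (intro shift_into_truncated_cone[OF _ near]) auto
  show ?thesis
  proof (rule is_free_convI[OF \<rho>, of 1 B'])
    show "is_F_inverse_on \<mu> (truncated_cone 1 B') g"
      using b1 g sub truncated_cone_mono[OF b(2), of 3]
      by (intro is_F_inverse_onI[where \<alpha> = 3 and \<beta> = b1]) (auto simp: subset_iff)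
    have FC: "F_transform (cauchy_distribution c) w = w + \<i> * of_real c" if "w \<in> truncated_cone 4 (B' - c)" for w
      using that B' F_transform_cauchy_distribution(2)[OF c] by (simp add: truncated_cone_iff)
    then have "inj_on (F_transform (cauchy_distribution c)) (truncated_cone 4 (B' - c))"
      by (simp add: inj_on_def)
    then show "is_F_inverse_on (cauchy_distribution c) (truncated_cone 1 B') (\<lambda>z. z - \<i> * of_real c)"
      using k FC B'(3) by (intro is_F_inverse_onI[where \<alpha> = 4 and \<beta> = "B' - c"]) auto
    have "F_transform \<rho> (g z - \<i> * of_real c) = z" if "z \<in> truncated_cone 1 B'" for z
    proof -
      have "Im (g z - \<i> * of_real c) > 0"
        using gk[OF that] b b2 by (simp add: truncated_cone_iff)
      then have "F_transform \<rho> (g z - \<i> * of_real c) = F_transform \<mu> (g z)"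
        by (subst F\<rho>) auto
      then show ?thesis
        using g(2) sub that by auto
    qed
    moreover have "g z - \<i> * of_real c \<in> truncated_cone 4 b2" if "z \<in> truncated_cone 1 B'" for z
      using gk[OF that] truncated_cone_mono[OF b(4)] by blast
    ultimately show "is_F_inverse_on \<rho> (truncated_cone 1 B') (\<lambda>z. g z - \<i> * of_real c)"
      using b2 by (intro is_F_inverse_onI[where \<alpha> = 4 and \<beta> = b2]) auto
  qed (use B B' c in auto)
qed

context subordination
begin

definition m3 :: real where "m3 = M3.expectation (\<lambda>x. x)"

definition V3 :: real where "V3 = M3.variance (\<lambda>x. x)"

lemma F3_near:
  assumes "e > 0" "Im w \<ge> e"
  shows "cmod (F_transform \<mu>\<^sub>3 w - w) \<le> \<bar>m3\<bar> + V3 / e"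
proof -
  have V0: "V3 \<ge> 0"
    unfolding V3_def by simp
  have "cmod (w - of_real m3 - F_transform \<mu>\<^sub>3 w) \<le> V3 / Im w"
    unfolding V3_def m3_def using assms by (intro M3.F_transform_near_shift square_integrable) auto
  also have "\<dots> \<le> V3 / e"
    using assms V0 by (intro divide_left_mono) auto
  moreover have "cmod (F_transform \<mu>\<^sub>3 w - w) \<le> cmod (w - of_real m3 - F_transform \<mu>\<^sub>3 w) + cmod (of_real m3)"
    using norm_triangle_ineq[of "w - of_real m3 - F_transform \<mu>\<^sub>3 w" "of_real m3"] by (simp add: norm_minus_commute)
  ultimately show ?thesis
    by simp
qed

text \<open>
  The measure that will be both free convolutions.
\<close>

lemma ex_free_conv_with_cauchy:
  "\<exists>\<rho>. real_distribution \<rho> \<and> (\<forall>z\<in>half_plane 0. F_transform \<rho> z = F_transform \<mu>\<^sub>3 (z + \<i> * of_real c))"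
proof (rule F_transform_exists)
  show "(\<lambda>z. F_transform \<mu>\<^sub>3 (z + \<i> * of_real c)) holomorphic_on half_plane 0"
    using c_nonneg
    by (intro holomorphic_on_compose_gen[OF _ M3.F_transform_holomorphic, unfolded o_def] holomorphic_intros) auto
  show "Im z \<le> Im (F_transform \<mu>\<^sub>3 (z + \<i> * of_real c))" if "Im z > 0" for z
    using M3.Im_F_transform_ge[of "z + \<i> * of_real c"] that c_nonneg by simp
  show "\<exists>K. \<forall>z. e \<le> Im z \<longrightarrow> cmod (F_transform \<mu>\<^sub>3 (z + \<i> * of_real c) - z) \<le> K" if e: "e > 0" for e
  proof (intro exI allI impI)
    fix z assume z: "e \<le> Im z"
    have "cmod (F_transform \<mu>\<^sub>3 (z + \<i> * of_real c) - (z + \<i> * of_real c)) \<le> \<bar>m3\<bar> + V3 / e"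
      using z c_nonneg by (intro F3_near[OF e]) auto
    moreover have "cmod (\<i> * of_real c) = c"
      using c_nonneg by (simp add: norm_mult)
    ultimately show "cmod (F_transform \<mu>\<^sub>3 (z + \<i> * of_real c) - z) \<le> \<bar>m3\<bar> + V3 / e + c"
      using norm_triangle_ineq[of "F_transform \<mu>\<^sub>3 (z + \<i> * of_real c) - (z + \<i> * of_real c)" "\<i> * of_real c"]
      by simp
  qed
qed

lemma F2_tilde_eq: "F2_tilde \<mu>\<^sub>1 \<mu>\<^sub>3 \<sigma>\<^sub>1 z = F_transform \<mu>\<^sub>3 (w3 \<mu>\<^sub>1 \<mu>\<^sub>3 (z + \<i> * of_real c))"
  by (simp add: F2_tilde_def c_def mult.commute)

lemma Im_w3_shift_ge:
  assumes "Im z > 0"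
  shows "Im (w3 \<mu>\<^sub>1 \<mu>\<^sub>3 (z + \<i> * of_real c)) \<ge> Im z"
proof -
  let ?z = "z + \<i> * complex_of_real c"
  have "cmod (w3 \<mu>\<^sub>1 \<mu>\<^sub>3 ?z - (?z + of_real m)) \<le> c / 4"
    using assms by (intro w3_near) simp
  then show ?thesis
    using abs_Im_le_cmod[of "w3 \<mu>\<^sub>1 \<mu>\<^sub>3 ?z - (?z + of_real m)"] c_nonneg by simp
qed

lemma F2_tilde_holomorphic: "F2_tilde \<mu>\<^sub>1 \<mu>\<^sub>3 \<sigma>\<^sub>1 holomorphic_on half_plane 0"
proof -
  have "(\<lambda>z. w3 \<mu>\<^sub>1 \<mu>\<^sub>3 (z + \<i> * of_real c)) holomorphic_on half_plane 0"
    by (intro holomorphic_on_compose_gen[OF _ w3_holomorphic, unfolded o_def] holomorphic_intros) auto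
  then show ?thesis
    unfolding F2_tilde_eq[abs_def]
    by (rule holomorphic_on_compose_gen[OF _ M3.F_transform_holomorphic, unfolded o_def])
       (auto intro: less_le_trans[OF _ Im_w3_shift_ge])
qed

lemma ex_F2_tilde_distribution:
  "\<exists>\<mu>. real_distribution \<mu> \<and> (\<forall>z\<in>half_plane 0. F_transform \<mu> z = F2_tilde \<mu>\<^sub>1 \<mu>\<^sub>3 \<sigma>\<^sub>1 z)"
proof (rule F_transform_exists[OF F2_tilde_holomorphic])
  show "Im z \<le> Im (F2_tilde \<mu>\<^sub>1 \<mu>\<^sub>3 \<sigma>\<^sub>1 z)" if "Im z > 0" for z
    using M3.Im_F_transform_ge[OF less_le_trans[OF that Im_w3_shift_ge[OF that]]] Im_w3_shift_ge[OF that]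
    by (simp add: F2_tilde_eq)
  show "\<exists>K. \<forall>z. e \<le> Im z \<longrightarrow> cmod (F2_tilde \<mu>\<^sub>1 \<mu>\<^sub>3 \<sigma>\<^sub>1 z - z) \<le> K" if e: "e > 0" for e
  proof (intro exI allI impI)
    fix z assume z: "e \<le> Im z"
    let ?z = "z + \<i> * complex_of_real c" and ?w = "w3 \<mu>\<^sub>1 \<mu>\<^sub>3 (z + \<i> * complex_of_real c)"
    have "cmod (F_transform \<mu>\<^sub>3 ?w - ?w) \<le> \<bar>m3\<bar> + V3 / e"
      using z e Im_w3_shift_ge[of z] by (intro F3_near[OF e]) auto
    moreover have "cmod (?w - (?z + of_real m)) \<le> c / 4"
      using z e by (intro w3_near) simp
    moreover have "cmod (\<i> * of_real c + of_real m) \<le> c + \<bar>m\<bar>"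
      using norm_triangle_ineq[of "\<i> * of_real c" "of_real m"] c_nonneg by (simp add: norm_mult)
    moreover have "F2_tilde \<mu>\<^sub>1 \<mu>\<^sub>3 \<sigma>\<^sub>1 z - z = (F_transform \<mu>\<^sub>3 ?w - ?w) + ((?w - (?z + of_real m)) + (\<i> * of_real c + of_real m))"
      by (simp add: F2_tilde_eq)
    ultimately show "cmod (F2_tilde \<mu>\<^sub>1 \<mu>\<^sub>3 \<sigma>\<^sub>1 z - z) \<le> (\<bar>m3\<bar> + V3 / e) + (c / 4 + (c + \<bar>m\<bar>))"
      by (simp only: norm_triangle_mono)
  qed
qed

text \<open>
  Let \<open>g\<close> invert the \<open>F\<close>-transform of \<open>\<mu>\<^sub>t\<close>, and for \<open>x\<close> in a cone put \<open>z = g x + i c\<close>, \<open>w = w\<^sub>3 z\<close> and \<open>a = x + w - z\<close>.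
  Then \<open>F\<^sub>3 w = x\<close> by the choice of \<open>z\<close>, so \<open>F\<^sub>1 a = x\<close> by the subordination identity, and \<open>w - i c\<close> is mapped to \<open>x\<close> by
  the \<open>F\<close>-transform of \<open>\<rho>\<close>.  These are the three inverses, and \<open>(w - i c) - x = (a - x) + (g x - x)\<close> holds by definition
  of \<open>a\<close>.  They take their values in cones because \<open>w - z\<close> is bounded.
\<close>

lemma is_free_conv_F2_tilde:
  assumes \<mu>t: "real_distribution \<mu>\<^sub>t" and \<rho>: "real_distribution \<rho>"
    and Ft: "\<And>z. Im z > 0 \<Longrightarrow> F_transform \<mu>\<^sub>t z = F2_tilde \<mu>\<^sub>1 \<mu>\<^sub>3 \<sigma>\<^sub>1 z"
    and F\<rho>: "\<And>z. Im z > 0 \<Longrightarrow> F_transform \<rho> z = F_transform \<mu>\<^sub>3 (z + \<i> * of_real c)"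
  shows "is_free_conv \<mu>\<^sub>1 \<mu>\<^sub>t \<rho>"
proof -
  obtain b1 where b1: "b1 > 0" "inj_on (F_transform \<mu>\<^sub>1) (truncated_cone 4 b1)"
    using M1.F_transform_inj_on_cone[of 4] by auto
  obtain bt where bt: "bt > 0" "inj_on (F_transform \<mu>\<^sub>t) (truncated_cone 3 bt)"
    using real_distribution.F_transform_inj_on_cone[OF \<mu>t, of 3] by auto
  obtain b\<rho> where b\<rho>: "b\<rho> > 0" "inj_on (F_transform \<rho>) (truncated_cone 4 b\<rho>)"
    using real_distribution.F_transform_inj_on_cone[OF \<rho>, of 4] by auto
  define K where "K = \<bar>m\<bar> + c / 4"
  have K0: "K \<ge> 0"
    using c_nonneg by (simp add: K_def)
  \<comment> \<open>The margin \<open>5 K\<close> is what a perturbation of size \<open>K\<close> needs to stay in the wider cone.\<close>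
  define b where "b = max bt (b\<rho> + 5 * K)"
  have b: "b > 0" "b \<ge> bt" "b \<ge> 5 * K" "b - K \<ge> b\<rho>"
    using bt b\<rho> K0 by (auto simp: b_def)
  obtain B g where B: "B > 0" and g: "\<And>z. z \<in> truncated_cone 1 B \<Longrightarrow> g z \<in> truncated_cone 3 b"
    "\<And>z. z \<in> truncated_cone 1 B \<Longrightarrow> F_transform \<mu>\<^sub>t (g z) = z"
    using real_distribution.F_transform_right_inverse[OF \<mu>t b(1)] by blast
  define B' where "B' = max B (b1 + 5 * K)"
  have B': "B' > 0" "B' \<ge> B" "B' \<ge> 5 * K" "B' - K \<ge> b1"
    using B b1 K0 by (auto simp: B'_def)
  have sub: "truncated_cone 1 B' \<subseteq> truncated_cone 1 B"
    by (rule truncated_cone_mono[OF B'(2)])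
  define w where "w x = w3 \<mu>\<^sub>1 \<mu>\<^sub>3 (g x + \<i> * of_real c)" for x
  define a where "a x = x + w x - (g x + \<i> * of_real c)" for x
  have pos: "Im (g x) > 0" if "x \<in> truncated_cone 1 B'" for x
    using g(1)[of x] sub that b(1) by (auto simp: truncated_cone_iff)
  have near: "cmod (w x - (g x + \<i> * of_real c)) \<le> K" if "x \<in> truncated_cone 1 B'" for x
  proof -
    let ?z = "g x + \<i> * complex_of_real c"
    have "cmod (w x - (?z + of_real m)) \<le> c / 4"
      unfolding w_def using pos[OF that] by (intro w3_near) simp
    then have "cmod ((w x - (?z + of_real m)) + of_real m) \<le> c / 4 + \<bar>m\<bar>"
      by (rule norm_triangle_mono) simp
    moreover have "(w x - (?z + of_real m)) + of_real m = w x - ?z"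
      by simp
    ultimately show ?thesis
      by (simp only: K_def add.commute)
  qed
  have F3w: "F_transform \<mu>\<^sub>3 (w x) = x" if "x \<in> truncated_cone 1 B'" for x
    using Ft[OF pos[OF that]] g(2)[of x] sub that by (auto simp: F2_tilde_eq w_def)
  have F1a: "F_transform \<mu>\<^sub>1 (a x) = x" if "x \<in> truncated_cone 1 B'" for x
    using subordination_identity[of "g x + \<i> * of_real c"] pos[OF that] F3w[OF that]
    by (simp add: a_def w_def)
  have F\<rho>w: "F_transform \<rho> (w x - \<i> * of_real c) = x" if "x \<in> truncated_cone 1 B'"
    "w x - \<i> * of_real c \<in> truncated_cone 4 b\<rho>" for x
    using F\<rho>[of "w x - \<i> * of_real c"] F3w[OF that(1)] that(2) b\<rho>(1) by (simp add: truncated_cone_iff)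
  have a_cone: "a x \<in> truncated_cone 4 b1" if "x \<in> truncated_cone 1 B'" for x
  proof -
    have "a x - x = w x - (g x + \<i> * of_real c)"
      by (simp add: a_def)
    then have "a x \<in> truncated_cone 4 (B' - K)"
      using near[OF that] that truncated_cone_1_subset_3[OF B'(1)] B'(3)
      by (intro shift_into_truncated_cone[of x]) auto
    then show ?thesis
      using truncated_cone_mono[OF B'(4)] by blast
  qed
  have w_cone: "w x - \<i> * of_real c \<in> truncated_cone 4 b\<rho>" if "x \<in> truncated_cone 1 B'" for x
  proof -
    have "w x - \<i> * of_real c \<in> truncated_cone 4 (b - K)"
      using near[OF that] g(1) sub that b(3)
      by (intro shift_into_truncated_cone[of "g x"]) (auto simp: algebra_simps)
    then show ?thesis
      using truncated_cone_mono[OF b(4)] by blast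
  qed
  show ?thesis
  proof (rule is_free_convI[OF \<rho>, of 1 B'])
    show "is_F_inverse_on \<mu>\<^sub>1 (truncated_cone 1 B') a"
      using b1 F1a a_cone by (intro is_F_inverse_onI[where \<alpha> = 4 and \<beta> = b1]) auto
    show "is_F_inverse_on \<mu>\<^sub>t (truncated_cone 1 B') g"
      using bt g sub truncated_cone_mono[OF b(2), of 3]
      by (intro is_F_inverse_onI[where \<alpha> = 3 and \<beta> = bt]) (auto simp: subset_iff)
    show "is_F_inverse_on \<rho> (truncated_cone 1 B') (\<lambda>x. w x - \<i> * of_real c)"
      using b\<rho> F\<rho>w w_cone by (intro is_F_inverse_onI[where \<alpha> = 4 and \<beta> = b\<rho>]) auto
    show "w x - \<i> * of_real c - x = (a x - x) + (g x - x)" for x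
      by (simp add: a_def algebra_simps)
  qed (use B' in auto)
qed

end

theorem theorem1p3:
  fixes \<mu>\<^sub>1 \<mu>\<^sub>3 :: "real measure" and \<sigma>\<^sub>1 \<sigma>\<^sub>3 :: real
  assumes "real_distribution \<mu>\<^sub>1" and "real_distribution \<mu>\<^sub>3"
    and "integrable \<mu>\<^sub>1 (\<lambda>x. x\<^sup>2)" and "integrable \<mu>\<^sub>3 (\<lambda>x. x\<^sup>2)"
    and "\<sigma>\<^sub>1 \<ge> 0" and "\<sigma>\<^sub>1\<^sup>2 = prob_space.variance \<mu>\<^sub>1 (\<lambda>x. x)"
    and "\<sigma>\<^sub>3 \<ge> 0" and "\<sigma>\<^sub>3\<^sup>2 = prob_space.variance \<mu>\<^sub>3 (\<lambda>x. x)"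
  shows "F2_tilde \<mu>\<^sub>1 \<mu>\<^sub>3 \<sigma>\<^sub>1 analytic_on half_plane 0 \<and>
    (\<exists>\<mu>\<^sub>t. real_distribution \<mu>\<^sub>t \<and>
       (\<forall>z\<in>half_plane 0. F2_tilde \<mu>\<^sub>1 \<mu>\<^sub>3 \<sigma>\<^sub>1 z = F_transform \<mu>\<^sub>t z) \<and>
       is_free_conv \<mu>\<^sub>1 \<mu>\<^sub>t (\<mu>\<^sub>1 \<boxplus> \<mu>\<^sub>t) \<and>
       is_free_conv \<mu>\<^sub>3 (cauchy_distribution (2 * sqrt 2 * \<sigma>\<^sub>1))
         (\<mu>\<^sub>3 \<boxplus> cauchy_distribution (2 * sqrt 2 * \<sigma>\<^sub>1)) \<and>
       \<mu>\<^sub>1 \<boxplus> \<mu>\<^sub>t = \<mu>\<^sub>3 \<boxplus> cauchy_distribution (2 * sqrt 2 * \<sigma>\<^sub>1))"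
proof -
  interpret subordination \<mu>\<^sub>1 \<mu>\<^sub>3 \<sigma>\<^sub>1
    using assms by (intro subordination.intro subordination_axioms.intro)
  obtain \<mu>\<^sub>t where \<mu>t: "real_distribution \<mu>\<^sub>t" "\<And>z. Im z > 0 \<Longrightarrow> F_transform \<mu>\<^sub>t z = F2_tilde \<mu>\<^sub>1 \<mu>\<^sub>3 \<sigma>\<^sub>1 z"
    using ex_F2_tilde_distribution by auto
  obtain \<rho> where \<rho>: "real_distribution \<rho>" "\<And>z. Im z > 0 \<Longrightarrow> F_transform \<rho> z = F_transform \<mu>\<^sub>3 (z + \<i> * of_real c)"
    using ex_free_conv_with_cauchy by auto
  have 1: "is_free_conv \<mu>\<^sub>1 \<mu>\<^sub>t \<rho>"
    by (rule is_free_conv_F2_tilde[OF \<mu>t(1) \<rho>(1) \<mu>t(2) \<rho>(2)])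
  have 2: "is_free_conv \<mu>\<^sub>3 (cauchy_distribution c) \<rho>"
    by (rule is_free_conv_cauchy_distribution[OF assms(2) \<rho>(1) c_nonneg \<rho>(2)])
  have 3: "\<mu>\<^sub>1 \<boxplus> \<mu>\<^sub>t = \<rho>"
    by (rule free_conv_eqI[OF assms(1) \<mu>t(1) 1])
  have 4: "\<mu>\<^sub>3 \<boxplus> cauchy_distribution c = \<rho>"
    by (rule free_conv_eqI[OF assms(2) F_transform_cauchy_distribution(1)[OF c_nonneg] 2])
  have "F2_tilde \<mu>\<^sub>1 \<mu>\<^sub>3 \<sigma>\<^sub>1 analytic_on half_plane 0"
    using F2_tilde_holomorphic by (simp add: analytic_on_open open_half_plane)
  then show ?thesis
    using \<mu>t 1 2 3 4 unfolding c_def by auto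
qed

end
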